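(* Let $b\in\mathscr{S}(n)$ and let $\alpha\in\mathcal{U}(n)$. Then the matrix-valued measures $\boldsymbol{\mu}_{\mathrm{s}}$ and $(I_n-\alpha^* )\boldsymbol{\mu}^\alpha_{\mathrm{s}}(I_n-\alpha)$ are vector mutually singular: $$\boldsymbol{\mu}_{\mathrm{s}}\perp(I_n-\alpha^* )\,\boldsymbol{\mu}^\alpha_{\mathrm{s}}\,(I_n-\alpha).$$
   Context: $\mathbb{D}$ is the open unit disc and $\mathbb{T}=\partial\mathbb{D}$. $\mathscr{S}(n)$ is the set of bounded analytic $n\times n$ matrix-valued functions $b$ on $\mathbb{D}$ with $\|b(z)\|<1$ (operator norm) for all $z\in\mathbb{D}$. $\mathcal{U}(n)$ is the group of unitary $n\times n$ matrices. For $b\in\mathscr{S}(n)$ and $\alpha\in\mathcal{U}(n)$, the Aleksandrov--Clark measure $\boldsymbol{\mu}^\alpha$ is the unique finite non-negative $\mathbb{C}^{n\times n}$-valued Borel measure on $\mathbb{T}$ such that, with $H_\alpha(z)=(I_n+b(z)\alpha^* )(I_n-b(z)\alpha^* )^{-1}$, $$H_\alpha(z)=i\,\mathrm{Im}\,H_\alpha(0)+\int_{\mathbb{T}}\frac{\zeta+z}{\zeta-z}\,\boldsymbol{\mu}^\alpha(\mathrm{d}\zeta),\qquad z\in\mathbb{D},$$ where $\mathrm{Im}\,A=(A-A^* )/(2i)$. We write $\boldsymbol{\mu}=\boldsymbol{\mu}^{I_n}$. The subscript $\mathrm{s}$ denotes the singular part with respect to Lebesgue measure on $\mathbb{T}$.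 For a matrix-valued measure $\boldsymbol{\nu}$ with $\mathrm{d}\boldsymbol{\nu}=V\,\mathrm{d}\nu$ ($\nu=\operatorname{tr}\boldsymbol{\nu}$) and a bounded Borel measurable matrix-valued function $\Theta$, the measure $\Theta^*\boldsymbol{\nu}\Theta$ is $E\mapsto\int_E\Theta(z)^*V(z)\Theta(z)\,\mathrm{d}\nu(z)$; in particular $(I_n-\alpha^* )\boldsymbol{\mu}^\alpha_{\mathrm{s}}(I_n-\alpha)$ is obtained with the constant function $\Theta=I_n-\alpha$. Two non-negative matrix-valued measures $\boldsymbol{\nu}_1,\boldsymbol{\nu}_2$ on $\mathbb{T}$ are vector mutually singular, written $\boldsymbol{\nu}_1\perp\boldsymbol{\nu}_2$, if there exists a measurable function $\Pi$ on $\mathbb{T}$ whose values are orthogonal projections on $\mathbb{C}^n$ such that $\Pi\boldsymbol{\nu}_1\Pi=\mathbf{0}$ and $(I-\Pi)\boldsymbol{\nu}_2(I-\Pi)=\mathbf{0}$ (the zero matrix-valued measure). *)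

theory Defs
  imports "HOL-Analysis.Analysis"
begin

section \<open>Complex matrices\<close>

definition cadjoint :: "complex^'n^'n \<Rightarrow> complex^'n^'n" where
  "cadjoint A = (\<chi> i j. cnj (A $ j $ i))"

definition cscale :: "complex \<Rightarrow> complex^'n^'n \<Rightarrow> complex^'n^'n"  (infixr "*\<^sub>C" 75) where
  "c *\<^sub>C A = (\<chi> i j. c * A $ i $ j)"

definition Im_matrix :: "complex^'n^'n \<Rightarrow> complex^'n^'n" where
  "Im_matrix A = (1 / (2 * \<i>)) *\<^sub>C (A - cadjoint A)"

definition unitary_matrix :: "complex^'n^'n \<Rightarrow> bool" where
  "unitary_matrix U \<longleftrightarrow> cadjoint U ** U = mat 1 \<and> U ** cadjoint U = mat 1"

definition orthogonal_projection :: "complex^'n^'n \<Rightarrow> bool" where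
  "orthogonal_projection P \<longleftrightarrow> P ** P = P \<and> cadjoint P = P"

text \<open>Over the complex numbers, a matrix with non-negative real quadratic form is automatically
  Hermitian.\<close>

definition nonneg_matrix :: "complex^'n^'n \<Rightarrow> bool" where
  "nonneg_matrix A \<longleftrightarrow> (\<forall>v. (\<Sum>i\<in>UNIV. cnj (v $ i) * (A *v v) $ i) \<in> \<real>\<^sub>\<ge>\<^sub>0)"

text \<open>The norm on \<^typ>\<open>complex^'n\<close> is the Euclidean one, so \<^const>\<open>onorm\<close> gives the operator norm.\<close>

definition Schur_class :: "(complex \<Rightarrow> complex^'n^'n) set" where
  "Schur_class = {b. (\<forall>i j. (\<lambda>z. b z $ i $ j) holomorphic_on ball 0 1) \<and>
     bounded (b ` ball 0 1) \<and> (\<forall>z\<in>ball 0 1. onorm ((*v) (b z)) < 1)}"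


section \<open>Matrix-valued measures on the unit circle\<close>

abbreviation circle_borel :: "complex measure" where
  "circle_borel \<equiv> restrict_space borel (sphere 0 1)"

definition circle_lebesgue :: "complex measure" where
  "circle_lebesgue = distr (uniform_measure lborel {0..<2*pi}) circle_borel cis"

text \<open>Matrix-valued measures are represented by set functions; only their values on the Borel
  subsets of the circle matter.\<close>

definition matrix_measure :: "(complex set \<Rightarrow> complex^'n^'n) \<Rightarrow> bool" where
  "matrix_measure \<mu> \<longleftrightarrow>
     (\<forall>E\<in>sets circle_borel. nonneg_matrix (\<mu> E)) \<and>
     (\<forall>A::nat \<Rightarrow> complex set. range A \<subseteq> sets circle_borel \<longrightarrow> disjoint_family A \<longrightarrow>
        (\<lambda>i. \<mu> (A i)) sums \<mu> (\<Union>i. A i))"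

definition trace_measure :: "(complex set \<Rightarrow> complex^'n^'n) \<Rightarrow> complex measure" where
  "trace_measure \<mu> =
     measure_of (sphere 0 1) (sets circle_borel) (\<lambda>E. ennreal (Re (trace (\<mu> E))))"

definition is_matrix_density ::
    "(complex set \<Rightarrow> complex^'n^'n) \<Rightarrow> (complex \<Rightarrow> complex^'n^'n) \<Rightarrow> bool" where
  "is_matrix_density \<mu> V \<longleftrightarrow> integrable (trace_measure \<mu>) V \<and>
     (\<forall>E\<in>sets circle_borel. \<mu> E = (LINT z:E|trace_measure \<mu>. V z))"

text \<open>The Radon--Nikodym density of a matrix measure with respect to its trace measure. It is
  determined almost everywhere, and it only occurs inside integrals against the trace measure.\<close>

definition matrix_density :: "(complex set \<Rightarrow> complex^'n^'n) \<Rightarrow> complex \<Rightarrow> complex^'n^'n" where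
  "matrix_density \<mu> = (SOME V. is_matrix_density \<mu> V)"

definition matrix_integral ::
    "(complex set \<Rightarrow> complex^'n^'n) \<Rightarrow> (complex \<Rightarrow> complex) \<Rightarrow> complex^'n^'n" where
  "matrix_integral \<mu> f = (LINT z|trace_measure \<mu>. f z *\<^sub>C matrix_density \<mu> z)"

text \<open>The measure \<open>\<Theta>\<^sup>* \<mu> \<Theta>\<close>.\<close>

definition congruence_measure ::
    "(complex \<Rightarrow> complex^'n^'n) \<Rightarrow> (complex set \<Rightarrow> complex^'n^'n) \<Rightarrow> complex set \<Rightarrow> complex^'n^'n"
  where
  "congruence_measure \<Theta> \<mu> E =
     (LINT z:E|trace_measure \<mu>. cadjoint (\<Theta> z) ** matrix_density \<mu> z ** \<Theta> z)"

definition lebesgue_decomposition ::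
    "(complex set \<Rightarrow> complex^'n^'n) \<Rightarrow> (complex set \<Rightarrow> complex^'n^'n) \<Rightarrow>
     (complex set \<Rightarrow> complex^'n^'n) \<Rightarrow> bool" where
  "lebesgue_decomposition \<mu> \<mu>a \<mu>s \<longleftrightarrow>
     matrix_measure \<mu>a \<and> matrix_measure \<mu>s \<and>
     (\<forall>E\<in>sets circle_borel. \<mu> E = \<mu>a E + \<mu>s E) \<and>
     (\<forall>E\<in>null_sets circle_lebesgue. \<mu>a E = 0) \<and>
     (\<exists>N\<in>null_sets circle_lebesgue. \<forall>E\<in>sets circle_borel. \<mu>s (E - N) = 0)"

text \<open>Unique on Borel sets, hence independent of the choice there.\<close>

definition singular_part ::
    "(complex set \<Rightarrow> complex^'n^'n) \<Rightarrow> complex set \<Rightarrow> complex^'n^'n" where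
  "singular_part \<mu> = (SOME \<mu>s. \<exists>\<mu>a. lebesgue_decomposition \<mu> \<mu>a \<mu>s)"

definition vector_mutually_singular ::
    "(complex set \<Rightarrow> complex^'n^'n) \<Rightarrow> (complex set \<Rightarrow> complex^'n^'n) \<Rightarrow> bool"
  where
  "vector_mutually_singular \<nu>1 \<nu>2 \<longleftrightarrow>
     (\<exists>P\<in>borel_measurable circle_borel.
        (\<forall>z\<in>sphere 0 1. orthogonal_projection (P z)) \<and>
        (\<forall>E\<in>sets circle_borel. congruence_measure P \<nu>1 E = 0) \<and>
        (\<forall>E\<in>sets circle_borel. congruence_measure (\<lambda>z. mat 1 - P z) \<nu>2 E = 0))"


section \<open>Aleksandrov--Clark measures\<close>

definition Clark_transform ::
    "(complex \<Rightarrow> complex^'n^'n) \<Rightarrow> complex^'n^'n \<Rightarrow> complex \<Rightarrow> complex^'n^'n" where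
  "Clark_transform b \<alpha> z =
     (mat 1 + b z ** cadjoint \<alpha>) ** matrix_inv (mat 1 - b z ** cadjoint \<alpha>)"

text \<open>For \<open>b\<close> in the Schur class and \<open>\<alpha>\<close> unitary, the Herglotz theorem provides a measure with this
  property, and its values on Borel sets are unique.\<close>

definition is_Clark_measure ::
    "(complex \<Rightarrow> complex^'n^'n) \<Rightarrow> complex^'n^'n \<Rightarrow> (complex set \<Rightarrow> complex^'n^'n) \<Rightarrow> bool" where
  "is_Clark_measure b \<alpha> \<mu> \<longleftrightarrow> matrix_measure \<mu> \<and>
     (\<forall>z\<in>ball 0 1. Clark_transform b \<alpha> z =
        \<i> *\<^sub>C Im_matrix (Clark_transform b \<alpha> 0) +
        matrix_integral \<mu> (\<lambda>\<zeta>. (\<zeta> + z) / (\<zeta> - z)))"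

end

theory Submission
  imports Defs
begin

text \<open>Write \<open>B = b(z)\<close>, \<open>A = (I - B)\<^sup>-\<^sup>1\<close> and \<open>A\<^sub>\<alpha> = (I - B\<alpha>\<^sup>*)\<^sup>-\<^sup>1\<close>. The Poisson extensions of \<open>\<mu>\<close> and
  \<open>\<mu>\<^sup>\<alpha>\<close> at \<open>z\<close> are \<open>R = A (I - BB\<^sup>*) A\<^sup>*\<close> and \<open>R\<^sub>\<alpha> = A\<^sub>\<alpha> (I - BB\<^sup>*) A\<^sub>\<alpha>\<^sup>*\<close>. The resolvent identity
  \<open>A (I - \<alpha>\<^sup>*) A\<^sub>\<alpha> = A - \<alpha>\<^sup>* A\<^sub>\<alpha>\<close> yields the two-weight bound \<open>\<parallel>R\<^sup>\<onehalf> (I - \<alpha>\<^sup>*) R\<^sub>\<alpha>\<^sup>\<onehalf>\<parallel> \<le> C\<close>, uniformly in \<open>z\<close>.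
  It survives shrinking either form, so for every Borel subset \<open>E\<close> of an arc of length \<open>h\<close> it gives
  \<open>\<parallel>\<mu>(E)\<^sup>\<onehalf> (I - \<alpha>\<^sup>*) \<mu>\<^sup>\<alpha>(E)\<^sup>\<onehalf>\<parallel> \<le> C h\<close>, also for the singular parts. If the product of their
  densities were bounded away from zero on a set \<open>F\<close>, the total mass of each such \<open>E \<subseteq> F\<close> would be at
  most a constant times \<open>h\<close>; as \<open>F\<close> may be taken Lebesgue null, \<open>F\<close> has no mass. So the densities have
  product zero, and the projection onto the kernel of the density of \<open>\<mu>\<^sub>s\<close> separates the measures.\<close>

section \<open>Matrices and the real inner product\<close>

text \<open>The inner product on \<open>complex^'n\<close> is the real part of the Hermitian one, so
  \<open>qform\<close> sees only the Hermitian part of \<open>A\<close>.\<close>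

abbreviation qform :: "complex^'n^'n \<Rightarrow> complex^'n \<Rightarrow> real" where
  "qform A x \<equiv> x \<bullet> (A *v x)"

lemma inner_complex_eq_Re: "(x::complex) \<bullet> y = Re (cnj x * y)"
  by (simp add: inner_complex_def)

lemma inner_complex_vec: "(x::complex^'n) \<bullet> y = Re (\<Sum>i\<in>UNIV. cnj (x $ i) * y $ i)"
  by (simp add: inner_vec_def inner_complex_eq_Re)

lemma cadjoint_inner: "(cadjoint A *v x) \<bullet> y = x \<bullet> (A *v y)"
proof -
  have "(\<Sum>i\<in>UNIV. cnj ((cadjoint A *v x) $ i) * y $ i)
      = (\<Sum>i\<in>UNIV. \<Sum>j\<in>UNIV. A $ j $ i * cnj (x $ j) * y $ i)"
    by (simp add: matrix_vector_mult_def cadjoint_def sum_distrib_right sum_distrib_left)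
  also have "\<dots> = (\<Sum>j\<in>UNIV. \<Sum>i\<in>UNIV. A $ j $ i * cnj (x $ j) * y $ i)"
    by (rule sum.swap)
  also have "\<dots> = (\<Sum>j\<in>UNIV. cnj (x $ j) * (A *v y) $ j)"
    by (simp add: matrix_vector_mult_def sum_distrib_left mult_ac)
  finally show ?thesis
    by (simp only: inner_complex_vec)
qed

lemma inner_cadjoint: "x \<bullet> (cadjoint A *v y) = (A *v x) \<bullet> y"
  by (metis cadjoint_inner inner_commute)

lemma cadjoint_cadjoint [simp]: "cadjoint (cadjoint A) = A"
  by (simp add: cadjoint_def vec_eq_iff)

lemma cadjoint_mult: "cadjoint (A ** B) = cadjoint B ** cadjoint A"
  by (simp add: cadjoint_def matrix_matrix_mult_def vec_eq_iff mult.commute)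

lemma cadjoint_mat_1 [simp]: "cadjoint (mat 1) = mat 1"
  by (simp add: cadjoint_def mat_def vec_eq_iff eq_commute)

lemma cadjoint_diff: "cadjoint (A - B) = cadjoint A - cadjoint B"
  by (simp add: cadjoint_def vec_eq_iff)

lemma cadjoint_add: "cadjoint (A + B) = cadjoint A + cadjoint B"
  by (simp add: cadjoint_def vec_eq_iff)

lemma bounded_linear_cadjoint: "bounded_linear (cadjoint :: complex^'n^'n \<Rightarrow> _)"
  by (rule linear_conv_bounded_linear[THEN iffD1])
     (auto intro!: linearI simp: cadjoint_def vec_eq_iff complex_eq_iff)

lemma scaleR_matrix_vector_mult: "(r *\<^sub>R A) *v (x::complex^'n) = r *\<^sub>R (A *v x)"
  by (simp add: vec_eq_iff matrix_vector_mult_def scaleR_right.sum)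

lemma matrix_vector_mult_scaleR: "A *v (r *\<^sub>R x) = r *\<^sub>R (A *v (x::complex^'n))"
  by (simp add: vec_eq_iff matrix_vector_mult_def scaleR_right.sum)

lemma matrix_mult_add_rdistrib: "(A + B) ** (C::complex^'n^'n) = A ** C + B ** C"
  by (simp add: vec_eq_iff matrix_matrix_mult_def sum.distrib distrib_right)

lemma scaleR_matrix_mult: "(r *\<^sub>R A) ** (B::complex^'n^'n) = r *\<^sub>R (A ** B)"
  by (simp add: vec_eq_iff matrix_matrix_mult_def scaleR_right.sum)

lemma matrix_mult_scaleR: "A ** (r *\<^sub>R B) = r *\<^sub>R (A ** (B::complex^'n^'n))"
  by (simp add: vec_eq_iff matrix_matrix_mult_def scaleR_right.sum)

lemma bounded_linear_inner_matrix_vector: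
  "bounded_linear (\<lambda>A::complex^'n^'n. x \<bullet> (A *v y))"
  by (rule linear_conv_bounded_linear[THEN iffD1])
     (auto intro!: linearI simp: matrix_vector_mult_add_rdistrib inner_add_right
       scaleR_matrix_vector_mult)

lemma linear_matrix_vector_mult: "linear ((*v) (A::complex^'n^'n))"
  by (auto intro!: linearI simp: matrix_vector_right_distrib matrix_vector_mult_scaleR)

lemma bounded_bilinear_matrix_mult:
  "bounded_bilinear ((**) :: complex^'n^'n \<Rightarrow> complex^'n^'n \<Rightarrow> complex^'n^'n)"
  by (rule bilinear_conv_bounded_bilinear[THEN iffD1])
     (auto simp: bilinear_def intro!: linearI simp: matrix_add_ldistrib matrix_mult_add_rdistrib
       scaleR_matrix_mult matrix_mult_scaleR)

lemma matrix_eqI_inner: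
  assumes "\<And>x y. x \<bullet> (A *v y) = x \<bullet> (B *v y)"
  shows "A = (B :: complex^'n^'n)"
  by (metis assms matrix_eq vector_eq_rdot inner_commute)

lemma cadjoint_eqI:
  assumes "\<And>x y. (A *v x) \<bullet> y = x \<bullet> (A *v y)"
  shows "cadjoint A = A"
  by (rule matrix_eqI_inner) (simp add: inner_cadjoint assms)

section \<open>Non-negative matrices and their quadratic forms\<close>

lemma inner_mult_i_left: "(\<i> *s x) \<bullet> (y::complex^'n) = Im (\<Sum>i\<in>UNIV. cnj (x $ i) * y $ i)"
  by (simp add: inner_complex_vec vector_scalar_mult_def algebra_simps)

lemma inner_mult_i: "(\<i> *s x) \<bullet> (\<i> *s (y::complex^'n)) = x \<bullet> y"
  by (simp add: inner_complex_vec vector_scalar_mult_def algebra_simps)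

lemma i_mult_i: "\<i> *s (\<i> *s (y::complex^'n)) = - y"
  by (simp add: vec_eq_iff vector_scalar_mult_def)

lemma matrix_vector_mult_i: "A *v (\<i> *s y) = \<i> *s (A *v (y::complex^'n))"
  by (simp add: vector_scalar_commute)

text \<open>A form without imaginary part polarises to a Hermitian matrix; conversely, the imaginary
  part of a Hermitian form equals its own negative. From here on the real inner product
  suffices.\<close>

lemma nonneg_matrix_iff:
  "nonneg_matrix A \<longleftrightarrow> cadjoint A = A \<and> (\<forall>x. 0 \<le> qform A x)"
proof
  assume "nonneg_matrix A"
  then have re: "0 \<le> qform A x" and im: "(\<i> *s x) \<bullet> (A *v x) = 0" for x
    by (auto simp: nonneg_matrix_def inner_mult_i_left inner_complex_vec complex_nonneg_Reals_iff)
  have pol: "(\<i> *s x) \<bullet> (A *v y) + (\<i> *s y) \<bullet> (A *v x) = 0" for x y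
    using im[of "x + y"] im[of x] im[of y]
    by (simp add: vector_add_ldistrib matrix_vector_right_distrib inner_add_left inner_add_right)
  \<comment> \<open>Replacing \<open>y\<close> by \<open>\<i> *s y\<close> turns the vanishing of
    imaginary parts into symmetry.\<close>
  have "(A *v x) \<bullet> y = x \<bullet> (A *v y)" for x y
    using pol[of x "\<i> *s y"]
    by (simp add: matrix_vector_mult_i inner_mult_i i_mult_i inner_commute)
  with re show "cadjoint A = A \<and> (\<forall>x. 0 \<le> qform A x)"
    by (auto intro: cadjoint_eqI)
next
  assume *: "cadjoint A = A \<and> (\<forall>x. 0 \<le> qform A x)"
  have "(\<i> *s x) \<bullet> (A *v x) = 0" for x
  proof -
    have "(\<i> *s x) \<bullet> (A *v x) = (A *v (\<i> *s x)) \<bullet> x"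
      using * inner_cadjoint[of "\<i> *s x" A x] by simp
    also have "\<dots> = (\<i> *s (\<i> *s (A *v x))) \<bullet> (\<i> *s x)"
      by (simp only: matrix_vector_mult_i inner_mult_i)
    also have "\<dots> = - ((\<i> *s x) \<bullet> (A *v x))"
      by (simp add: i_mult_i inner_commute)
    finally show ?thesis by simp
  qed
  with * show "nonneg_matrix A"
    by (auto simp: nonneg_matrix_def inner_mult_i_left inner_complex_vec complex_nonneg_Reals_iff)
qed

lemma nonneg_matrix_qform: "nonneg_matrix A \<Longrightarrow> 0 \<le> qform A x"
  by (simp add: nonneg_matrix_iff)

lemma nonneg_matrix_sym: "nonneg_matrix A \<Longrightarrow> (A *v x) \<bullet> y = x \<bullet> (A *v y)"
  by (metis nonneg_matrix_iff cadjoint_inner)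

lemma nonneg_matrix_sym': "nonneg_matrix A \<Longrightarrow> x \<bullet> (A *v y) = y \<bullet> (A *v x)"
  by (metis nonneg_matrix_sym inner_commute)

lemma nonneg_matrixI:
  assumes "\<And>x y. (A *v x) \<bullet> y = x \<bullet> (A *v y)" "\<And>x. 0 \<le> qform A x"
  shows "nonneg_matrix A"
  using assms by (simp add: nonneg_matrix_iff cadjoint_eqI)

lemma nonneg_matrix_0 [simp]: "nonneg_matrix 0"
  by (rule nonneg_matrixI) (simp_all add: matrix_vector_mult_0)

lemma nonneg_matrix_add: "nonneg_matrix A \<Longrightarrow> nonneg_matrix B \<Longrightarrow> nonneg_matrix (A + B)"
  by (simp add: nonneg_matrix_iff cadjoint_add matrix_vector_mult_add_rdistrib inner_add_right)

lemma nonneg_matrix_scaleR: "nonneg_matrix A \<Longrightarrow> 0 \<le> r \<Longrightarrow> nonneg_matrix (r *\<^sub>R A)"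
  by (rule nonneg_matrixI)
     (simp_all add: scaleR_matrix_vector_mult nonneg_matrix_sym nonneg_matrix_qform)

lemma nonneg_matrix_congruence:
  "nonneg_matrix A \<Longrightarrow> nonneg_matrix (cadjoint C ** A ** C)"
  by (rule nonneg_matrixI)
     (simp_all add: matrix_vector_mul_assoc[symmetric] cadjoint_inner inner_cadjoint
       nonneg_matrix_sym nonneg_matrix_qform)

text \<open>The form at \<open>x + t *\<^sub>R y\<close> is a quadratic polynomial in
  \<open>t\<close> without negative values. Being stated for real symmetry, the lemma also applies
  directly to defects such as \<open>mat 1 - cadjoint B ** B\<close>.\<close>

lemma qform_cauchy_schwarz:
  assumes "\<And>x y. x \<bullet> (A *v y) = y \<bullet> (A *v x)" "\<And>x. 0 \<le> qform A x"
  shows "\<bar>x \<bullet> (A *v y)\<bar> \<le> sqrt (qform A x) * sqrt (qform A y)"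
proof -
  have q: "0 \<le> qform A x + 2 * t * (x \<bullet> (A *v y)) + t\<^sup>2 * qform A y" for t
    using assms(2)[of "x + t *\<^sub>R y"]
    by (simp add: matrix_vector_right_distrib matrix_vector_mult_scaleR inner_add_left
        inner_add_right assms(1)[of y x] power2_eq_square algebra_simps)
  have "(x \<bullet> (A *v y))\<^sup>2 \<le> qform A x * qform A y"
  proof (cases "qform A y = 0")
    case True
    have "x \<bullet> (A *v y) = 0"
    proof (rule ccontr)
      assume "x \<bullet> (A *v y) \<noteq> 0"
      \<comment> \<open>At this \<open>t\<close> the polynomial, which is linear when
        \<open>qform A y = 0\<close>, takes the value -1.\<close>
      then show False
        using q[of "- (qform A x + 1) / (2 * (x \<bullet> (A *v y)))"] True by (simp add: field_simps)
    qed
    then show ?thesis using True by simp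
  next
    case False
    then have "0 < qform A y" using assms(2)[of y] by simp
    then show ?thesis
      using q[of "- (x \<bullet> (A *v y)) / qform A y"]
      by (simp add: field_simps power2_eq_square)
  qed
  then show ?thesis
    by (metis abs_le_square_iff real_sqrt_abs real_sqrt_le_mono real_sqrt_mult)
qed

lemma nonneg_matrix_cauchy_schwarz:
  "nonneg_matrix A \<Longrightarrow> \<bar>x \<bullet> (A *v y)\<bar> \<le> sqrt (qform A x) * sqrt (qform A y)"
  by (intro qform_cauchy_schwarz nonneg_matrix_sym' nonneg_matrix_qform)

lemma qform_axis: "qform A (axis i c) = (cmod c)\<^sup>2 * Re (A $ i $ i)"
proof -
  have 1: "(A *v axis i c) $ i = c * A $ i $ i"
    by (simp add: matrix_vector_mult_def axis_def if_distrib cong: if_cong)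
  have "qform A (axis i c) = Re (cnj c * (c * A $ i $ i))"
    by (simp add: inner_axis' 1 inner_complex_eq_Re)
  also have "cnj c * (c * A $ i $ i) = of_real ((cmod c)\<^sup>2) * A $ i $ i"
    by (simp only: complex_norm_square mult_ac)
  finally show ?thesis by simp
qed

text \<open>No eigenvalues are used: \<open>x\<close> splits into coordinate vectors, on which the
  form is a diagonal entry times \<open>(cmod (x $ j))\<^sup>2\<close>, and Cauchy-Schwarz is
  applied first to the form and then to the sum.\<close>

lemma qform_le_trace:
  fixes A :: "complex^'n^'n"
  assumes "nonneg_matrix A"
  shows "qform A x \<le> Re (trace A) * (norm x)\<^sup>2"
proof -
  define y where "y = (\<lambda>j. axis j (x $ j) :: complex^'n)"
  have x: "x = (\<Sum>j\<in>UNIV. y j)"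
    by (simp add: y_def vec_eq_iff axis_def if_distrib cong: if_cong)
  have d: "0 \<le> Re (A $ i $ i)" for i
    using nonneg_matrix_qform[OF assms, of "axis i 1"] by (simp add: qform_axis)
  let ?q = "sqrt (qform A x)"
  have "qform A x = (\<Sum>j\<in>UNIV. y j \<bullet> (A *v x))"
    by (subst (1) x) (simp add: inner_sum_left)
  also have "\<dots> \<le> (\<Sum>j\<in>UNIV. sqrt (qform A (y j)) * ?q)"
    by (rule sum_mono) (rule order_trans[OF abs_ge_self nonneg_matrix_cauchy_schwarz[OF assms]])
  also have "\<dots> = (\<Sum>j\<in>UNIV. cmod (x $ j) * sqrt (Re (A $ j $ j))) * ?q"
    by (simp add: sum_distrib_right y_def qform_axis real_sqrt_mult)
  finally have "?q * ?q \<le> (\<Sum>j\<in>UNIV. cmod (x $ j) * sqrt (Re (A $ j $ j))) * ?q"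
    using nonneg_matrix_qform[OF assms, of x] by simp
  then have "?q \<le> (\<Sum>j\<in>UNIV. cmod (x $ j) * sqrt (Re (A $ j $ j)))"
    using nonneg_matrix_qform[OF assms, of x] d
    by (cases "?q = 0")
      (auto intro!: sum_nonneg mult_nonneg_nonneg
        mult_right_le_imp_le[where c = ?q and a = ?q] simp del: real_sqrt_mult_self)
  then have "?q\<^sup>2 \<le> (\<Sum>j\<in>UNIV. cmod (x $ j) * sqrt (Re (A $ j $ j)))\<^sup>2"
    using nonneg_matrix_qform[OF assms, of x] by (intro power_mono) auto
  also have "\<dots> \<le> (\<Sum>j\<in>UNIV. (cmod (x $ j))\<^sup>2) * (\<Sum>j\<in>UNIV. (sqrt (Re (A $ j $ j)))\<^sup>2)"
    by (rule Cauchy_Schwarz_ineq_sum)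
  also have "(\<Sum>j\<in>UNIV. (cmod (x $ j))\<^sup>2) = (norm x)\<^sup>2"
    by (simp add: norm_vec_def L2_set_def sum_nonneg)
  also have "(\<Sum>j\<in>UNIV. (sqrt (Re (A $ j $ j)))\<^sup>2) = Re (trace A)"
    using d by (simp add: trace_def)
  finally show ?thesis
    using nonneg_matrix_qform[OF assms, of x] by (simp add: mult.commute)
qed

lemma trace_nonneg: "nonneg_matrix A \<Longrightarrow> 0 \<le> Re (trace A)"
  using nonneg_matrix_qform[of A "axis i 1" for i]
  by (auto simp: trace_def qform_axis intro!: sum_nonneg)

text \<open>A vanishing trace kills the quadratic form, and Cauchy-Schwarz then kills all bilinear
  values. Hence null sets of the trace measure carry no matrix mass.\<close>

lemma nonneg_matrix_eq_0:
  assumes "nonneg_matrix A" "Re (trace A) \<le> 0"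
  shows "A = 0"
proof (rule matrix_eqI_inner)
  have "qform A x = 0" for x
    using qform_le_trace[OF assms(1), of x] nonneg_matrix_qform[OF assms(1), of x] assms(2)
    by (smt (verit) mult_nonpos_nonneg zero_le_power2)
  then show "x \<bullet> (A *v y) = x \<bullet> (0 *v y)" for x y
    using nonneg_matrix_cauchy_schwarz[OF assms(1), of x y] by simp
qed

lemma bounded_linear_Re_trace: "bounded_linear (\<lambda>A::complex^'n^'n. Re (trace A))"
  by (rule linear_conv_bounded_linear[THEN iffD1])
     (auto intro!: linearI simp: trace_def sum.distrib sum_distrib_left)

text \<open>Closedness lets the averaging theorem carry non-negativity from a measure to its
  density.\<close>

lemma closed_nonneg_matrix: "closed {A :: complex^'n^'n. nonneg_matrix A}"
proof -
  have "{A :: complex^'n^'n. nonneg_matrix A} = {A. cadjoint A = A} \<inter> (\<Inter>x. {A. 0 \<le> qform A x})"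
    by (auto simp: nonneg_matrix_iff)
  moreover have "closed {A :: complex^'n^'n. cadjoint A = A}"
    by (intro closed_Collect_eq continuous_intros
        linear_continuous_on[OF bounded_linear_cadjoint])
  moreover have "closed {A. 0 \<le> qform A x}" for x :: "complex^'n"
    by (intro closed_Collect_le continuous_intros
        linear_continuous_on[OF bounded_linear_inner_matrix_vector])
  ultimately show ?thesis by (simp add: closed_Int closed_INT)
qed

section \<open>Contractions\<close>

text \<open>Cauchy-Schwarz for the defect form of \<open>B\<close>, which is non-negative because
  \<open>B\<close> is a contraction.\<close>

lemma inner_defect_le:
  assumes "\<And>x. norm (B *v x) \<le> norm x"
  shows "\<bar>(x::complex^'n) \<bullet> ((mat 1 - cadjoint B ** B) *v y)\<bar>
    \<le> sqrt ((norm x)\<^sup>2 - (norm (B *v x))\<^sup>2) * sqrt ((norm y)\<^sup>2 - (norm (B *v y))\<^sup>2)"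
proof -
  have *: "x \<bullet> ((mat 1 - cadjoint B ** B) *v y) = x \<bullet> y - (B *v x) \<bullet> (B *v y)" for x y
    by (simp add: matrix_vector_mult_diff_rdistrib inner_diff_right inner_cadjoint
        flip: matrix_vector_mul_assoc)
  show ?thesis
    using qform_cauchy_schwarz[of "mat 1 - cadjoint B ** B" x y] assms
    by (simp add: * inner_commute dot_square_norm)
qed

text \<open>With \<open>D = I - B B\<^sup>*\<close> and \<open>D' = I - B\<^sup>* B\<close> this says that \<open>D'\<^sup>\<onehalf> (I - B)\<^sup>-\<^sup>1 D\<^sup>\<onehalf>\<close> is bounded by an
  absolute constant.\<close>

lemma defect_resolvent_bound:
  fixes y u :: "complex^'n"
  assumes B: "\<And>x. norm (B *v x) \<le> norm x"
    and u: "u - B *v u = y - B *v (cadjoint B *v y)"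
  shows "(norm u)\<^sup>2 - (norm (B *v u))\<^sup>2 \<le> 6 * ((norm y)\<^sup>2 - (norm (cadjoint B *v y))\<^sup>2)"
proof -
  \<comment> \<open>With D and D' as above, \<open>d\<close> is D applied to \<open>y\<close>,
    \<open>X\<close> is the form of D at \<open>y\<close>, and \<open>S\<close> and \<open>T\<close>
    are the forms of D' at \<open>u\<close> and \<open>g\<close>.\<close>
  define g where "g = cadjoint B *v y"
  define d where "d = y - B *v g"
  define S where "S = (norm u)\<^sup>2 - (norm (B *v u))\<^sup>2"
  define T where "T = (norm g)\<^sup>2 - (norm (B *v g))\<^sup>2"
  define X where "X = (norm y)\<^sup>2 - (norm g)\<^sup>2"
  have S0: "0 \<le> S" and T0: "0 \<le> T"
    using B by (simp_all add: S_def T_def power_mono)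
  have yB: "y \<bullet> (B *v x) = g \<bullet> x" for x
    by (simp add: g_def cadjoint_inner)
  have Bu: "B *v u = u - d" using u by (simp add: d_def g_def algebra_simps)
  \<comment> \<open>The operator identity D = D^2 + B D' \<open>cadjoint B\<close>, tested on
    \<open>y\<close>.\<close>
  have dX: "(norm d)\<^sup>2 + T = X"
  proof -
    have "(norm d)\<^sup>2 = y \<bullet> y - 2 * (y \<bullet> (B *v g)) + (B *v g) \<bullet> (B *v g)"
      by (simp add: d_def power2_norm_eq_inner inner_diff_left inner_diff_right inner_commute)
    then show ?thesis
      by (simp add: T_def X_def yB power2_norm_eq_inner)
  qed
  have "S = 2 * (u \<bullet> d) - d \<bullet> d"
    by (simp add: S_def Bu power2_norm_eq_inner inner_diff_left inner_diff_right inner_commute)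
  \<comment> \<open>Here \<open>u\<close> is paired with \<open>g\<close> through D' only, so it
    enters the bound as \<open>sqrt S\<close> and not through its norm, which is not
    controlled.\<close>
  also have "u \<bullet> d = d \<bullet> d + (g \<bullet> u - (B *v g) \<bullet> (B *v u))"
  proof -
    have "g \<bullet> u = y \<bullet> u - y \<bullet> d" using yB[of u] by (simp add: Bu inner_diff_right)
    moreover have "(B *v g) \<bullet> (B *v u) = (y - d) \<bullet> (u - d)" by (simp add: Bu d_def)
    ultimately show ?thesis
      by (simp add: inner_diff_left inner_diff_right inner_commute)
  qed
  also have "g \<bullet> u - (B *v g) \<bullet> (B *v u) = g \<bullet> ((mat 1 - cadjoint B ** B) *v u)"
    by (simp add: matrix_vector_mult_diff_rdistrib inner_diff_right inner_cadjoint
        flip: matrix_vector_mul_assoc)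
  finally have "S = d \<bullet> d + 2 * (g \<bullet> ((mat 1 - cadjoint B ** B) *v u))" by simp
  then have "S \<le> (X - T) + 2 * (sqrt T * sqrt S)"
    using inner_defect_le[OF B, of g u] dX by (simp add: S_def T_def power2_norm_eq_inner)
  \<comment> \<open>Half of \<open>S\<close> is absorbed on the left, leaving
    \<open>S \<le> 2 * X + 2 * T\<close>; with \<open>T \<le> X\<close> this is within
    \<open>6 * X\<close>.\<close>
  moreover have "2 * (sqrt T * sqrt S) \<le> 2 * T + S / 2"
  proof -
    have "0 \<le> (2 * sqrt T - sqrt S)\<^sup>2" by simp
    moreover have "(2 * sqrt T - sqrt S)\<^sup>2 = 4 * T + S - 4 * (sqrt T * sqrt S)"
      using S0 T0 by (simp add: power2_diff power_mult_distrib)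
    ultimately show ?thesis by simp
  qed
  moreover have "T \<le> X" using dX by (smt (verit) zero_le_power2)
  ultimately have "S \<le> 6 * X" using T0 by simp
  then show ?thesis by (simp add: S_def X_def g_def)
qed

section \<open>Strict contractions and the real part of their Cayley transforms\<close>

definition strict_contraction :: "complex^'n^'n \<Rightarrow> bool" where
  "strict_contraction B \<longleftrightarrow> (\<forall>x. x \<noteq> 0 \<longrightarrow> norm (B *v x) < norm x)"

lemma strict_contraction_le: "strict_contraction B \<Longrightarrow> norm (B *v x) \<le> norm x"
  by (cases "x = 0") (auto simp: strict_contraction_def less_imp_le)

lemma strict_contraction_inj:
  assumes "strict_contraction B" "(mat 1 - B) *v x = 0"
  shows "x = 0"
  using assms by (force simp: strict_contraction_def matrix_vector_mult_diff_rdistrib)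

lemma strict_contraction_unitary:
  assumes "strict_contraction B" "unitary_matrix \<alpha>"
  shows "strict_contraction (B ** cadjoint \<alpha>)"
proof -
  have "norm (cadjoint \<alpha> *v x) = norm x" for x
    using assms(2)
    by (simp add: norm_eq_sqrt_inner cadjoint_inner matrix_vector_mul_assoc unitary_matrix_def)
  then show ?thesis
    using assms(1) unfolding strict_contraction_def
    by (metis matrix_vector_mul_assoc norm_eq_zero)
qed

lemma matrix_inv_strict_contraction:
  fixes B :: "complex^'n^'n"
  assumes "strict_contraction B"
  defines "M \<equiv> mat 1 - B"
  shows "M ** matrix_inv M = mat 1" "matrix_inv M ** M = mat 1"
proof -
  have "invertible M"
    using strict_contraction_inj[OF assms(1)]
    by (auto simp: invertible_left_inverse matrix_left_invertible_ker M_def)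
  then show "M ** matrix_inv M = mat 1" "matrix_inv M ** M = mat 1"
    unfolding matrix_inv_def invertible_def by (metis (mono_tags, lifting) someI_ex)+
qed

text \<open>If \<open>H = (I + B) (I - B)\<^sup>-\<^sup>1\<close>, then the Hermitian part of \<open>H\<close> is \<open>(I - B)\<^sup>-\<^sup>1 (I - B B\<^sup>*) (I - B\<^sup>*)\<^sup>-\<^sup>1\<close>.\<close>

definition Cayley_real :: "complex^'n^'n \<Rightarrow> complex^'n^'n" where
  "Cayley_real B = matrix_inv (mat 1 - B) ** (mat 1 - B ** cadjoint B) ** cadjoint (matrix_inv (mat 1 - B))"

lemma norm_cadjoint_le:
  assumes B: "\<And>x. norm (B *v x) \<le> norm (x::complex^'n)"
  shows "norm (cadjoint B *v x) \<le> norm x"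
proof -
  have "(norm (cadjoint B *v x))\<^sup>2 = x \<bullet> (B *v (cadjoint B *v x))"
    by (simp add: power2_norm_eq_inner cadjoint_inner)
  also have "\<dots> \<le> norm x * norm (cadjoint B *v x)"
    by (rule order_trans[OF norm_cauchy_schwarz mult_left_mono[OF B]]) simp
  finally show ?thesis
    by (cases "cadjoint B *v x = 0") (auto simp: power2_eq_square)
qed

text \<open>With \<open>A\<close> the inverse of \<open>mat 1 - B\<close>, the form factors in two
  ways: through the defect of \<open>cadjoint B\<close> at \<open>y = cadjoint A *v w\<close> (third
  clause) and through the defect of \<open>B\<close> at \<open>t = A *v x\<close> (fourth clause).
  Both are stated as vector equations, so that later arguments need no inverse.\<close>

lemma Cayley_real_qform:
  fixes B :: "complex^'n^'n"
  assumes B: "strict_contraction B"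
  shows "nonneg_matrix (Cayley_real B)"
    and "qform (Cayley_real B) w = qform ((mat 1 + B) ** matrix_inv (mat 1 - B)) w"
    and "\<exists>y f. Cayley_real B *v w = f \<and> f - B *v f = y - B *v (cadjoint B *v y) \<and>
           qform (Cayley_real B) w = (norm y)\<^sup>2 - (norm (cadjoint B *v y))\<^sup>2"
    and "\<exists>t. t - B *v t = x \<and> qform (Cayley_real B) x = (norm t)\<^sup>2 - (norm (B *v t))\<^sup>2"
proof -
  define A where "A = matrix_inv (mat 1 - B)"
  note B' = strict_contraction_le[OF B]
  note inv = matrix_inv_strict_contraction[OF B, folded A_def]
  have A1: "A *v x - B *v (A *v x) = x" for x
    using arg_cong[OF inv(1), where f = "\<lambda>M. M *v x"]
    by (simp add: matrix_vector_mult_diff_rdistrib flip: matrix_vector_mul_assoc)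
  have A2: "A *v (x - B *v x) = x" for x
    using arg_cong[OF inv(2), where f = "\<lambda>M. M *v x"]
    by (simp add: matrix_vector_mult_diff_rdistrib flip: matrix_vector_mul_assoc)
  have A3: "cadjoint A *v (x - cadjoint B *v x) = x" for x
    using arg_cong[OF inv(1), where f = "\<lambda>M. cadjoint M *v x"]
    by (simp add: matrix_vector_mult_diff_rdistrib cadjoint_mult cadjoint_diff
        flip: matrix_vector_mul_assoc)
  have A4: "cadjoint A *v x - cadjoint B *v (cadjoint A *v x) = x" for x
    using arg_cong[OF inv(2), where f = "\<lambda>M. cadjoint M *v x"]
    by (simp add: matrix_vector_mult_diff_rdistrib cadjoint_mult cadjoint_diff
        flip: matrix_vector_mul_assoc)
  let ?R = "Cayley_real B"
  have R: "?R *v w = A *v (cadjoint A *v w - B *v (cadjoint B *v (cadjoint A *v w)))" for w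
    by (simp add: Cayley_real_def A_def matrix_vector_mult_diff_rdistrib flip: matrix_vector_mul_assoc)
  have q: "qform ?R w = (norm (cadjoint A *v w))\<^sup>2 - (norm (cadjoint B *v (cadjoint A *v w)))\<^sup>2" for w
    by (simp add: R flip: cadjoint_inner)
       (simp add: inner_diff_right power2_norm_eq_inner cadjoint_inner)
  show "nonneg_matrix ?R"
  proof (rule nonneg_matrixI)
    show "(?R *v x) \<bullet> y = x \<bullet> (?R *v y)" for x y
    proof -
      have "x \<bullet> (?R *v y) = (cadjoint A *v x) \<bullet> (cadjoint A *v y)
          - (cadjoint B *v (cadjoint A *v x)) \<bullet> (cadjoint B *v (cadjoint A *v y))" for x y
        by (simp only: R cadjoint_inner[symmetric] inner_diff_right)
      from this[of x y] this[of y x] show ?thesis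
        by (simp add: inner_commute)
    qed
    show "0 \<le> qform ?R x" for x
      using norm_cadjoint_le[OF B'] by (simp add: q power_mono)
  qed
  show H: "qform ?R w = qform ((mat 1 + B) ** matrix_inv (mat 1 - B)) w" for w
  proof -
    define y where "y = cadjoint A *v w"
    have w: "w = y - cadjoint B *v y" by (simp add: y_def A4)
    have "qform ((mat 1 + B) ** A) w = (cadjoint A *v (w + cadjoint B *v w)) \<bullet> w"
      by (metis (no_types, lifting) cadjoint_add cadjoint_inner cadjoint_mat_1 cadjoint_mult
          matrix_vector_mul_assoc matrix_vector_mul_lid matrix_vector_mult_add_rdistrib)
    \<comment> \<open>The sum and the difference of \<open>mat 1\<close> and
      \<open>cadjoint B\<close> commute, so the difference can be put outermost, where
      \<open>cadjoint A\<close> cancels it.\<close>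
    also have "w + cadjoint B *v w = (y + cadjoint B *v y) - cadjoint B *v (y + cadjoint B *v y)"
      by (simp add: w matrix_vector_mult_diff_distrib matrix_vector_right_distrib)
    also have "cadjoint A *v \<dots> = y + cadjoint B *v y" by (rule A3)
    also have "\<dots> \<bullet> w = (norm y)\<^sup>2 - (norm (cadjoint B *v y))\<^sup>2"
      by (simp add: w power2_norm_eq_inner inner_diff_right inner_diff_left inner_add_left
          inner_add_right inner_commute)
    finally show ?thesis by (simp add: q y_def A_def)
  qed
  show "\<exists>y f. ?R *v w = f \<and> f - B *v f = y - B *v (cadjoint B *v y) \<and>
           qform ?R w = (norm y)\<^sup>2 - (norm (cadjoint B *v y))\<^sup>2"
    by (rule exI[of _ "cadjoint A *v w"], rule exI[of _ "?R *v w"])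
       (simp add: q del: R, simp add: R A1)
  show "\<exists>t. t - B *v t = x \<and> qform ?R x = (norm t)\<^sup>2 - (norm (B *v t))\<^sup>2"
  proof (intro exI conjI)
    let ?t = "A *v x"
    show t: "?t - B *v ?t = x" by (rule A1)
    \<comment> \<open>The detour through \<open>(mat 1 + B) ** A\<close> replaces the defect of
      \<open>cadjoint B\<close> by that of \<open>B\<close>.\<close>
    have "qform ?R x = x \<bullet> (?t + B *v ?t)"
      by (simp only: H A_def[symmetric] flip: matrix_vector_mul_assoc)
         (simp add: matrix_vector_mult_add_rdistrib)
    also have "\<dots> = (?t - B *v ?t) \<bullet> (?t + B *v ?t)" by (simp add: t)
    also have "\<dots> = (norm ?t)\<^sup>2 - (norm (B *v ?t))\<^sup>2"
      by (simp add: power2_norm_eq_inner inner_diff_left inner_diff_right inner_add_left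
          inner_add_right inner_commute)
    finally show "qform ?R x = (norm ?t)\<^sup>2 - (norm (B *v ?t))\<^sup>2" .
  qed
qed

text \<open>The resolvent identity in vector form is \<open>t = e - h\<close>. Both resolvents act
  on the same vector \<open>y - B *v (cadjoint B *v y)\<close>, because \<open>B\<close> and
  \<open>B ** cadjoint \<alpha>\<close> have the same product with their adjoints, and
  \<open>defect_resolvent_bound\<close> controls each of \<open>e\<close> and
  \<open>h\<close>.\<close>

lemma Cayley_real_coupling:
  fixes B \<alpha> :: "complex^'n^'n"
  assumes B: "strict_contraction B" and \<alpha>: "unitary_matrix \<alpha>"
  shows "qform (Cayley_real B) ((mat 1 - cadjoint \<alpha>) *v (Cayley_real (B ** cadjoint \<alpha>) *v w))
    \<le> 24 * qform (Cayley_real (B ** cadjoint \<alpha>)) w"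
proof -
  let ?C = "B ** cadjoint \<alpha>"
  have \<alpha>': "\<alpha> *v (cadjoint \<alpha> *v x) = x" "cadjoint \<alpha> *v (\<alpha> *v x) = x" for x
    using \<alpha> by (simp_all add: unitary_matrix_def matrix_vector_mul_assoc)
  have n\<alpha>: "norm (cadjoint \<alpha> *v x) = norm x" for x
    by (simp add: norm_eq_sqrt_inner cadjoint_inner \<alpha>')
  have C: "?C *v x = B *v (cadjoint \<alpha> *v x)" for x
    by (simp flip: matrix_vector_mul_assoc)
  have Ca: "cadjoint ?C *v x = \<alpha> *v (cadjoint B *v x)" for x
    by (simp add: cadjoint_mult flip: matrix_vector_mul_assoc)
  have CC: "?C *v (cadjoint ?C *v x) = B *v (cadjoint B *v x)" for x
    by (simp add: C Ca \<alpha>')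
  have nCa: "norm (cadjoint ?C *v x) = norm (cadjoint B *v x)" for x
    by (metis Ca \<alpha>'(2) n\<alpha>)
  note C1 = strict_contraction_unitary[OF B \<alpha>]
  note B' = strict_contraction_le[OF B]
  note C' = strict_contraction_le[OF C1]
  obtain y f where f: "Cayley_real ?C *v w = f" "f - ?C *v f = y - ?C *v (cadjoint ?C *v y)"
      "qform (Cayley_real ?C) w = (norm y)\<^sup>2 - (norm (cadjoint ?C *v y))\<^sup>2"
    using Cayley_real_qform(3)[OF C1, of w] by metis
  \<comment> \<open>The clause serves only to solve this equation for \<open>e\<close>.\<close>
  obtain e where e: "e - B *v e = y - B *v (cadjoint B *v y)"
    using Cayley_real_qform(4)[OF B, of "y - B *v (cadjoint B *v y)"] by metis
  obtain t where t: "t - B *v t = (mat 1 - cadjoint \<alpha>) *v f"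
      "qform (Cayley_real B) ((mat 1 - cadjoint \<alpha>) *v f) = (norm t)\<^sup>2 - (norm (B *v t))\<^sup>2"
    using Cayley_real_qform(4)[OF B, of "(mat 1 - cadjoint \<alpha>) *v f"] by metis
  define h where "h = cadjoint \<alpha> *v f"
  have "(mat 1 - B) *v (t - (e - h)) = 0"
    using t(1) e f(2)
    by (simp add: matrix_vector_mult_diff_rdistrib matrix_vector_mult_diff_distrib CC)
       (simp add: C h_def algebra_simps)
  then have "t - (e - h) = 0" by (rule strict_contraction_inj[OF B])
  then have th: "t = e - h" by simp
  define D' where "D' = mat 1 - cadjoint B ** B"
  have D': "qform D' x = (norm x)\<^sup>2 - (norm (B *v x))\<^sup>2" for x
    by (simp add: D'_def matrix_vector_mult_diff_rdistrib inner_diff_right inner_cadjoint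
        power2_norm_eq_inner flip: matrix_vector_mul_assoc)
  have pos: "0 \<le> qform D' x" for x by (simp add: D' B' power_mono)
  \<comment> \<open>Parallelogram law: its factor 2, applied to two bounds with constant 6, makes up
    the 24.\<close>
  have "qform D' (e - h) + qform D' (e + h) = 2 * qform D' e + 2 * qform D' h"
    by (simp add: matrix_vector_mult_diff_distrib matrix_vector_right_distrib inner_diff_left
        inner_diff_right inner_add_left inner_add_right)
  then have "qform D' t \<le> 2 * qform D' e + 2 * qform D' h"
    using pos[of "e + h"] by (simp add: th)
  also have "qform D' e \<le> 6 * ((norm y)\<^sup>2 - (norm (cadjoint B *v y))\<^sup>2)"
    unfolding D' by (rule defect_resolvent_bound[OF B' e])
  \<comment> \<open>\<open>h\<close> has the same defect under \<open>B\<close> as \<open>f\<close>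
    has under \<open>?C\<close>, so the resolvent bound for \<open>?C\<close> applies.\<close>
  also have "qform D' h \<le> 6 * ((norm y)\<^sup>2 - (norm (cadjoint B *v y))\<^sup>2)"
    using defect_resolvent_bound[OF C' f(2)] by (simp add: D' h_def n\<alpha> C nCa)
  finally show ?thesis
    using f t(2) by (simp add: D' nCa)
qed

text \<open>Hypothesis and conclusion give the same bound for the operator A^(1/2) X B^(1/2) and for
  its adjoint. Square roots of matrices are avoided by testing the hypothesis at
  \<open>w = cadjoint X *v (A *v v)\<close> and cancelling a factor
  \<open>sqrt (qform B w)\<close>.\<close>

lemma coupling_swap:
  fixes A B X :: "complex^'n^'n"
  assumes A: "nonneg_matrix A" and B: "nonneg_matrix B" and K: "0 \<le> K"
    and le: "\<And>w. qform A (X *v (B *v w)) \<le> K * qform B w"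
  shows "qform B (cadjoint X *v (A *v v)) \<le> K * qform A v"
proof -
  define w where "w = cadjoint X *v (A *v v)"
  have "qform B w = (X *v (B *v w)) \<bullet> (A *v v)"
    by (metis w_def cadjoint_inner inner_commute)
  also have "\<dots> \<le> sqrt (qform A (X *v (B *v w))) * sqrt (qform A v)"
    using nonneg_matrix_cauchy_schwarz[OF A, of "X *v (B *v w)" v] by simp
  also have "\<dots> \<le> sqrt (K * qform B w) * sqrt (qform A v)"
    using le nonneg_matrix_qform[OF A] by (intro mult_right_mono) auto
  also have "\<dots> = sqrt (qform B w) * sqrt (K * qform A v)"
    by (simp add: real_sqrt_mult)
  finally have *: "sqrt (qform B w) * sqrt (qform B w) \<le> sqrt (qform B w) * sqrt (K * qform A v)"
    using nonneg_matrix_qform[OF B] by simp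
  show ?thesis
  proof (cases "qform B w = 0")
    case True
    then show ?thesis using K nonneg_matrix_qform[OF A] by (simp flip: w_def)
  next
    case False
    then have "0 < sqrt (qform B w)" using nonneg_matrix_qform[OF B, of w] by simp
    with * have "sqrt (qform B w) \<le> sqrt (K * qform A v)"
      by (rule mult_left_le_imp_le)
    then show ?thesis by (simp flip: w_def)
  qed
qed

text \<open>The coupling inequality in terms of the two measures of one small arc: it survives passing to
  smaller matrices because each application of \<open>coupling_swap\<close> frees one of the two forms.\<close>

lemma Cayley_real_coupling_mono:
  fixes B \<alpha> M N :: "complex^'n^'n"
  assumes B: "strict_contraction B" and \<alpha>: "unitary_matrix \<alpha>"
    and M: "nonneg_matrix M" "\<And>x. qform M x \<le> c * qform (Cayley_real B) x"
    and N: "nonneg_matrix N" "\<And>x. qform N x \<le> c * qform (Cayley_real (B ** cadjoint \<alpha>)) x"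
    and c: "0 \<le> c"
  shows "qform N ((mat 1 - \<alpha>) *v (M *v v)) \<le> 24 * c\<^sup>2 * qform M v"
proof -
  let ?X = "mat 1 - cadjoint \<alpha>" and ?R = "Cayley_real (B ** cadjoint \<alpha>)"
  note C1 = strict_contraction_unitary[OF B \<alpha>]
  have "qform M (?X *v (?R *v w)) \<le> (24 * c) * qform ?R w" for w
    using M(2)[of "?X *v (?R *v w)"]
      mult_left_mono[OF Cayley_real_coupling[OF B \<alpha>, of w] c] by simp
  \<comment> \<open>\<open>M\<close> has replaced the Cayley form of \<open>B\<close>; after the
    swap the other Cayley form stands outside, where it dominates \<open>N\<close>.\<close>
  then have "qform ?R (cadjoint ?X *v (M *v v)) \<le> (24 * c) * qform M v"
    using c by (intro coupling_swap[OF M(1) Cayley_real_qform(1)[OF C1]]) auto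
  then have "c * qform ?R (cadjoint ?X *v (M *v v)) \<le> c * ((24 * c) * qform M v)"
    using c by (rule mult_left_mono)
  then show ?thesis
    using N(2)[of "cadjoint ?X *v (M *v v)"] by (simp add: cadjoint_diff power2_eq_square)
qed

section \<open>The projection onto the kernel of a contraction\<close>

lemmas matrix_diff_distribs =
  bounded_bilinear.diff_left[OF bounded_bilinear_matrix_mult]
  bounded_bilinear.diff_right[OF bounded_bilinear_matrix_mult]

primrec mpow :: "complex^'n^'n \<Rightarrow> nat \<Rightarrow> complex^'n^'n" where
  "mpow T 0 = mat 1"
| "mpow T (Suc k) = T ** mpow T k"

lemma mpow_add: "mpow T (j + k) = mpow T j ** mpow T k"
  by (induction j) (simp_all add: matrix_mul_assoc)

lemma mpow_Suc2: "mpow T (Suc k) = mpow T k ** T"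
  using mpow_add[of T k 1] by simp

lemma cadjoint_mpow: "cadjoint T = T \<Longrightarrow> cadjoint (mpow T k) = mpow T k"
  by (induction k) (simp_all add: cadjoint_mult, simp flip: mpow_Suc2)

text \<open>No spectral theorem is needed: the forms \<open>a x\<close> of the powers decrease and
  so converge, and the squared distance of \<open>mpow T j *v x\<close> and
  \<open>mpow T k *v x\<close> is \<open>a x (j + j) - 2 * a x (j + k) + a x (k + k)\<close>, which
  makes these vectors Cauchy.\<close>

lemma mpow_convergent:
  fixes T :: "complex^'n^'n"
  assumes T: "nonneg_matrix T" and le: "\<And>x. qform T x \<le> (norm x)\<^sup>2"
  shows "convergent (mpow T)"
proof -
  have adj: "cadjoint T = T" using T by (simp add: nonneg_matrix_iff)
  have sym: "x \<bullet> (mpow T j *v y) = (mpow T j *v x) \<bullet> y" for x y j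
    by (metis cadjoint_mpow[OF adj] cadjoint_inner)
  have T2: "(norm (T *v x))\<^sup>2 \<le> qform T x" for x
  proof -
    have "(norm (T *v x))\<^sup>2 = (T *v x) \<bullet> (T *v x)" by (simp add: power2_norm_eq_inner)
    also have "\<dots> \<le> sqrt (qform T (T *v x)) * sqrt (qform T x)"
      using nonneg_matrix_cauchy_schwarz[OF T, of "T *v x" x] by simp
    also have "\<dots> \<le> norm (T *v x) * sqrt (qform T x)"
      by (intro mult_right_mono real_le_lsqrt le) (simp_all add: nonneg_matrix_qform[OF T])
    finally have "norm (T *v x) \<le> sqrt (qform T x)"
      by (cases "T *v x = 0") (auto simp: power2_eq_square nonneg_matrix_qform[OF T])
    then show ?thesis
      by (metis nonneg_matrix_qform[OF T] norm_ge_zero power_mono real_sqrt_pow2)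
  qed
  define a where "a = (\<lambda>x j. qform (mpow T j) x)"
  \<comment> \<open>Split by parity, each step of the decrease becomes an instance of T <= I or of
    T^2 <= T at a vector \<open>mpow T j *v x\<close>.\<close>
  have even: "a x (j + j) = (norm (mpow T j *v x))\<^sup>2" for x j
    by (simp add: a_def mpow_add sym power2_norm_eq_inner flip: matrix_vector_mul_assoc)
  have odd: "a x (Suc (j + j)) = qform T (mpow T j *v x)" for x j
  proof -
    have "mpow T (Suc (j + j)) = mpow T j ** (T ** mpow T j)"
      using mpow_add[of T j "Suc j"] by simp
    then show ?thesis
      by (simp only: a_def) (simp add: sym flip: matrix_vector_mul_assoc)
  qed
  have dec: "a x (Suc j) \<le> a x j" for x j
  proof (cases "even j")
    case True
    then obtain m where "j = m + m" by (metis evenE mult_2)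
    then show ?thesis using odd[of x m] even[of x m] le by simp
  next
    case False
    then obtain m where m: "j = Suc (m + m)" by (metis oddE mult_2 Suc_eq_plus1)
    have "a x (Suc m + Suc m) = (norm (T *v (mpow T m *v x)))\<^sup>2"
      unfolding even by (simp add: matrix_vector_mul_assoc)
    then show ?thesis using odd[of x m] T2 m by simp
  qed
  have nn: "0 \<le> a x j" for x j
  proof (cases "even j")
    case True
    then show ?thesis by (metis evenE mult_2 even zero_le_power2)
  next
    case False
    then show ?thesis
      by (metis oddE mult_2 Suc_eq_plus1 odd nonneg_matrix_qform[OF T])
  qed
  have conv: "convergent (a x)" for x
  proof -
    have "decseq (a x)" by (rule decseq_SucI) (rule dec)
    then obtain L where "a x \<longlonglongrightarrow> L" using nn decseq_convergent by metis
    then show ?thesis by (rule convergentI)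
  qed
  have Cau: "Cauchy (\<lambda>j. mpow T j *v x)" for x
  proof (rule metric_CauchyI)
    fix e :: real assume e: "0 < e"
    have "Cauchy (a x)" using conv by (simp add: Cauchy_convergent_iff)
    then obtain n where n: "\<And>j k. j \<ge> n \<Longrightarrow> k \<ge> n \<Longrightarrow> \<bar>a x j - a x k\<bar> < e\<^sup>2 / 2"
      using e unfolding Cauchy_def dist_real_def by (metis half_gt_zero zero_less_power)
    have "dist (mpow T j *v x) (mpow T k *v x) < e" if "j \<ge> n" "k \<ge> n" for j k
    proof -
      have "a x (j + k) = (mpow T j *v x) \<bullet> (mpow T k *v x)"
        by (simp add: a_def mpow_add sym[of x j] flip: matrix_vector_mul_assoc)
      then have "(dist (mpow T j *v x) (mpow T k *v x))\<^sup>2 = (a x (j + j) - a x (j + k)) - (a x (j + k) - a x (k + k))"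
        by (simp add: even dist_norm power2_norm_eq_inner inner_diff_left inner_diff_right inner_commute)
      also have "\<dots> < e\<^sup>2"
        using n[of "j + j" "j + k"] n[of "j + k" "k + k"] that by linarith
      finally show ?thesis using e by (simp add: power_less_imp_less_base)
    qed
    then show "\<exists>M. \<forall>m\<ge>M. \<forall>n\<ge>M. dist (mpow T m *v x) (mpow T n *v x) < e" by blast
  qed
  have "convergent (\<lambda>k. mpow T k *v x)" for x
    using Cau by (simp add: Cauchy_convergent_iff)
  then obtain l where l: "\<And>x. (\<lambda>k. mpow T k *v x) \<longlonglongrightarrow> l x"
    unfolding convergent_def by metis
  have "mpow T \<longlonglongrightarrow> (\<chi> i j. l (axis j 1) $ i)"
  proof (intro vec_tendstoI)
    fix i j
    have "(\<lambda>k. (mpow T k *v axis j 1) $ i) \<longlonglongrightarrow> l (axis j 1) $ i"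
      by (intro tendsto_intros l)
    moreover have "(mpow T k *v axis j 1) $ i = mpow T k $ i $ j" for k
      by (simp add: matrix_vector_mult_def axis_def if_distrib cong: if_cong)
    ultimately show "(\<lambda>k. mpow T k $ i $ j) \<longlonglongrightarrow> (\<chi> i j. l (axis j 1) $ i) $ i $ j"
      by simp
  qed
  then show ?thesis by (rule convergentI)
qed

text \<open>As a limit of powers, the projection is a measurable function of \<open>W\<close> and
  can be applied pointwise to a density.\<close>

definition kernel_projection :: "complex^'n^'n \<Rightarrow> complex^'n^'n" where
  "kernel_projection W = lim (mpow (mat 1 - W))"

text \<open>The trace bound gives 0 <= W <= I, so the powers of T = I - W converge. Their limit is
  fixed by T, hence annihilated by \<open>W\<close>; and \<open>Z ** W = 0\<close> means
  \<open>Z ** T = Z\<close>, which survives the limit.\<close>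

lemma kernel_projection:
  fixes W :: "complex^'n^'n"
  assumes W: "nonneg_matrix W" and tr: "Re (trace W) \<le> 1"
  shows "orthogonal_projection (kernel_projection W)"
    and "W ** kernel_projection W = 0"
    and "\<And>Z :: complex^'n^'n. Z ** W = 0 \<Longrightarrow> Z ** (mat 1 - kernel_projection W) = 0"
proof -
  define T where "T = mat 1 - W"
  have adjW: "cadjoint W = W" using W by (simp add: nonneg_matrix_iff)
  have adj: "cadjoint T = T" by (simp add: T_def cadjoint_diff adjW)
  have qT: "qform T x = (norm x)\<^sup>2 - qform W x" for x
    by (simp add: T_def matrix_vector_mult_diff_rdistrib inner_diff_right power2_norm_eq_inner)
  have "qform W x \<le> (norm x)\<^sup>2" for x
    using qform_le_trace[OF W, of x] mult_right_mono[OF tr, of "(norm x)\<^sup>2"] by simp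
  then have T: "nonneg_matrix T" by (simp add: nonneg_matrix_iff adj qT)
  have "convergent (mpow T)"
    by (rule mpow_convergent[OF T]) (simp add: qT nonneg_matrix_qform[OF W])
  then have lim: "mpow T \<longlonglongrightarrow> kernel_projection W"
    by (simp add: kernel_projection_def T_def convergent_LIMSEQ_iff)
  let ?P = "kernel_projection W"
  note tm = bounded_bilinear.tendsto[OF bounded_bilinear_matrix_mult]
  have TP: "T ** ?P = ?P"
  proof (rule LIMSEQ_unique)
    show "(\<lambda>k. mpow T (Suc k)) \<longlonglongrightarrow> T ** ?P"
      using tm[OF tendsto_const lim] by simp
    show "(\<lambda>k. mpow T (Suc k)) \<longlonglongrightarrow> ?P" using lim by (rule LIMSEQ_Suc)
  qed
  then show "W ** ?P = 0"
    by (simp add: T_def matrix_diff_distribs) 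
  have "mpow T k ** ?P = ?P" for k
    by (induction k) (simp_all add: TP flip: matrix_mul_assoc)
  then have "?P ** ?P = ?P"
    using tm[OF lim tendsto_const, of ?P] by (simp add: LIMSEQ_const_iff)
  moreover have "cadjoint ?P = ?P"
    using bounded_linear.tendsto[OF bounded_linear_cadjoint lim] lim
    by (simp add: cadjoint_mpow[OF adj] LIMSEQ_unique)
  ultimately show "orthogonal_projection ?P" by (simp add: orthogonal_projection_def)
  fix Z :: "complex^'n^'n" assume Z: "Z ** W = 0"
  have "Z ** T = Z" by (simp add: T_def matrix_diff_distribs Z)
  then have "Z ** mpow T k = Z" for k
    by (induction k) (simp_all add: matrix_mul_assoc)
  then have "Z ** ?P = Z"
    using tm[OF tendsto_const lim, of Z] by (simp add: LIMSEQ_const_iff)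
  then show "Z ** (mat 1 - ?P) = 0" by (simp add: matrix_diff_distribs)
qed

lemma measurable_kernel_projection:
  assumes [measurable]: "W \<in> borel_measurable M"
  shows "(\<lambda>z. kernel_projection (W z) :: complex^'n^'n) \<in> borel_measurable M"
proof -
  have "(\<lambda>z. mpow (mat 1 - W z) k) \<in> borel_measurable M" for k
  proof (induction k)
    case (Suc k)
    note [measurable] = Suc
    have "continuous_on UNIV (\<lambda>p :: (complex^'n^'n) \<times> (complex^'n^'n). fst p ** snd p)"
      by (intro bounded_bilinear.continuous_on[OF bounded_bilinear_matrix_mult] continuous_intros)
    then show ?case
      using borel_measurable_continuous_Pair[of "\<lambda>z. mat 1 - W z" M "\<lambda>z. mpow (mat 1 - W z) k" "(**)"]
      by simp
  qed simp
  then have "(\<lambda>z. lim (\<lambda>k. mpow (mat 1 - W z) k)) \<in> borel_measurable M"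
    by (rule borel_measurable_lim_metric)
  then show ?thesis by (simp add: kernel_projection_def)
qed

section \<open>Matrix measures\<close>

text \<open>\<open>\<phi>\<close> will be the trace or a quadratic form, both non-negative on
  non-negative matrices.\<close>

definition scalar_measure ::
    "(complex^'n^'n \<Rightarrow> real) \<Rightarrow> (complex set \<Rightarrow> complex^'n^'n) \<Rightarrow> complex measure" where
  "scalar_measure \<phi> \<nu> =
     measure_of (sphere 0 1) (sets circle_borel) (\<lambda>E. ennreal (\<phi> (\<nu> E)))"

lemma trace_measure_eq: "trace_measure = scalar_measure (\<lambda>A. Re (trace A))"
  by (simp add: fun_eq_iff trace_measure_def scalar_measure_def)

lemma space_circle_borel [simp]: "space circle_borel = sphere 0 1"
  by (simp add: space_restrict_space)

lemma sigma_algebra_circle: "sigma_algebra (sphere 0 1) (sets circle_borel)"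
  using sets.sigma_algebra_axioms[of circle_borel] by simp

lemma space_scalar_measure [simp]: "space (scalar_measure \<phi> \<nu>) = sphere 0 1"
  by (simp add: scalar_measure_def space_measure_of_conv)

lemma sets_scalar_measure [simp, measurable_cong]: "sets (scalar_measure \<phi> \<nu>) = sets circle_borel"
  unfolding scalar_measure_def by (rule sigma_algebra.sets_measure_of_eq[OF sigma_algebra_circle])

lemma space_trace_measure [simp]: "space (trace_measure \<nu>) = sphere 0 1"
  by (simp add: trace_measure_eq)

lemma sets_trace_measure [simp, measurable_cong]: "sets (trace_measure \<nu>) = sets circle_borel"
  by (simp add: trace_measure_eq)

lemma matrix_measure_nonneg:
  "matrix_measure \<nu> \<Longrightarrow> E \<in> sets circle_borel \<Longrightarrow> nonneg_matrix (\<nu> E)"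
  by (simp add: matrix_measure_def)

lemma matrix_measure_sums:
  "matrix_measure \<nu> \<Longrightarrow> range A \<subseteq> sets circle_borel \<Longrightarrow> disjoint_family A \<Longrightarrow>
    (\<lambda>i::nat. \<nu> (A i)) sums \<nu> (\<Union>i. A i)"
  by (simp add: matrix_measure_def)

lemma matrix_measure_empty:
  assumes "matrix_measure \<nu>"
  shows "\<nu> {} = 0"
proof -
  have "(\<lambda>i::nat. \<nu> {}) sums \<nu> {}"
    using matrix_measure_sums[OF assms, of "\<lambda>_. {}"] by (simp add: disjoint_family_on_def)
  then show ?thesis
    using summable_LIMSEQ_zero sums_summable LIMSEQ_const_iff by blast
qed

lemma matrix_measure_add:
  "matrix_measure \<nu>1 \<Longrightarrow> matrix_measure \<nu>2 \<Longrightarrow> matrix_measure (\<lambda>E. \<nu>1 E + \<nu>2 E)"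
  by (auto simp: matrix_measure_def nonneg_matrix_add intro!: sums_add)

lemma matrix_measure_Un:
  assumes \<nu>: "matrix_measure \<nu>" and AB: "A \<in> sets circle_borel" "B \<in> sets circle_borel" "A \<inter> B = {}"
  shows "\<nu> (A \<union> B) = \<nu> A + \<nu> B"
proof -
  have "(\<lambda>i. \<nu> (binaryset A B i)) sums \<nu> (\<Union>i. binaryset A B i)"
    using AB by (intro matrix_measure_sums[OF \<nu>])
      (auto simp: range_binaryset_eq disjoint_family_on_def binaryset_def)
  moreover have "(\<lambda>i. \<nu> (binaryset A B i)) sums (\<nu> A + \<nu> B)"
    using matrix_measure_empty[OF \<nu>] by (rule binaryset_sums)
  ultimately show ?thesis
    by (simp add: UN_binaryset_eq sums_unique2)
qed

lemma emeasure_scalar_measure: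
  assumes \<nu>: "matrix_measure \<nu>" and \<phi>: "bounded_linear \<phi>"
    and nn: "\<And>A. nonneg_matrix A \<Longrightarrow> 0 \<le> \<phi> A" and E: "E \<in> sets circle_borel"
  shows "emeasure (scalar_measure \<phi> \<nu>) E = ennreal (\<phi> (\<nu> E))"
  unfolding scalar_measure_def
proof (rule emeasure_measure_of_sigma[OF sigma_algebra_circle _ _ E])
  show "positive (sets circle_borel) (\<lambda>E. ennreal (\<phi> (\<nu> E)))"
    by (simp add: positive_def matrix_measure_empty[OF \<nu>] linear_0 bounded_linear.linear[OF \<phi>])
  show "countably_additive (sets circle_borel) (\<lambda>E. ennreal (\<phi> (\<nu> E)))"
    by (intro countably_additiveI suminf_ennreal_eq bounded_linear.sums[OF \<phi>]
        matrix_measure_sums[OF \<nu>] nn matrix_measure_nonneg[OF \<nu>]) auto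
qed

lemma finite_scalar_measure:
  assumes "matrix_measure \<nu>" "bounded_linear \<phi>" "\<And>A. nonneg_matrix A \<Longrightarrow> 0 \<le> \<phi> A"
  shows "finite_measure (scalar_measure \<phi> \<nu>)"
  using sets.top[of circle_borel]
  by (intro finite_measureI) (simp add: emeasure_scalar_measure[OF assms] del: sets.top)

lemma emeasure_trace_measure:
  "matrix_measure \<nu> \<Longrightarrow> E \<in> sets circle_borel \<Longrightarrow>
    emeasure (trace_measure \<nu>) E = ennreal (Re (trace (\<nu> E)))"
  unfolding trace_measure_eq
  by (intro emeasure_scalar_measure bounded_linear_Re_trace trace_nonneg)

lemma measure_trace_measure:
  "matrix_measure \<nu> \<Longrightarrow> E \<in> sets circle_borel \<Longrightarrow> measure (trace_measure \<nu>) E = Re (trace (\<nu> E))"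
  by (simp add: measure_def emeasure_trace_measure trace_nonneg matrix_measure_nonneg)

lemma finite_trace_measure: "matrix_measure \<nu> \<Longrightarrow> finite_measure (trace_measure \<nu>)"
  unfolding trace_measure_eq
  by (intro finite_scalar_measure bounded_linear_Re_trace trace_nonneg)

lemma trace_measure_null:
  "matrix_measure \<nu> \<Longrightarrow> E \<in> null_sets (trace_measure \<nu>) \<Longrightarrow> \<nu> E = 0"
  by (intro nonneg_matrix_eq_0 matrix_measure_nonneg)
     (auto simp: null_sets_def emeasure_trace_measure ennreal_eq_0_iff)

section \<open>Radon-Nikodym densities of matrix measures\<close>

lemma scalar_density_exists:
  fixes \<phi> :: "complex^'n^'n \<Rightarrow> real"
  assumes \<nu>: "matrix_measure \<nu>" and \<phi>: "bounded_linear \<phi>"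
    and nn: "\<And>A. nonneg_matrix A \<Longrightarrow> 0 \<le> \<phi> A"
    and \<sigma>: "finite_measure \<sigma>" "sets \<sigma> = sets circle_borel"
    and ac: "\<And>E. E \<in> null_sets \<sigma> \<Longrightarrow> \<nu> E = 0"
  shows "\<exists>g. integrable \<sigma> g \<and> (\<forall>E\<in>sets circle_borel. \<phi> (\<nu> E) = (LINT z:E|\<sigma>. g z))"
proof -
  interpret finite_measure \<sigma> by fact
  let ?N = "scalar_measure \<phi> \<nu>"
  have em: "emeasure ?N E = ennreal (\<phi> (\<nu> E))" if "E \<in> sets circle_borel" for E
    using that by (intro emeasure_scalar_measure \<nu> \<phi> nn)
  interpret N: finite_measure ?N by (rule finite_scalar_measure[OF \<nu> \<phi> nn])
  have ac': "absolutely_continuous \<sigma> ?N"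
    using ac \<sigma>(2) by (auto simp: absolutely_continuous_def null_sets_def em linear_0
        bounded_linear.linear[OF \<phi>])
  obtain g where g: "g \<in> borel_measurable \<sigma>" "AE x in \<sigma>. RN_deriv \<sigma> ?N x = ennreal (g x)" "\<And>x. 0 \<le> g x"
    using real_RN_deriv[OF N.finite_measure_axioms ac'] \<sigma>(2) by (metis sets_scalar_measure)
  have N: "?N = density \<sigma> g"
    using density_RN_deriv[OF ac'] density_cong[OF borel_measurable_RN_deriv _ g(2)] g(1) \<sigma>(2) by simp
  have 1: "(\<integral>\<^sup>+ z. ennreal (indicator E z *\<^sub>R g z) \<partial>\<sigma>) = ennreal (\<phi> (\<nu> E))" if E: "E \<in> sets circle_borel" for E
  proof -
    have "ennreal (\<phi> (\<nu> E)) = emeasure (density \<sigma> g) E" using em[OF E] N by simp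
    also have "\<dots> = (\<integral>\<^sup>+ z. ennreal (g z) * indicator E z \<partial>\<sigma>)"
      using E \<sigma>(2) g(1) by (intro emeasure_density) auto
    also have "\<dots> = (\<integral>\<^sup>+ z. ennreal (indicator E z *\<^sub>R g z) \<partial>\<sigma>)"
      by (intro nn_integral_cong) (auto simp: indicator_def)
    finally show ?thesis by simp
  qed
  have "integrable \<sigma> g"
  proof (rule integrableI_nonneg)
    have "(\<integral>\<^sup>+ z. ennreal (g z) \<partial>\<sigma>) = (\<integral>\<^sup>+ z. ennreal (indicator (space \<sigma>) z *\<^sub>R g z) \<partial>\<sigma>)"
      by (intro nn_integral_cong) (auto simp: indicator_def)
    then show "(\<integral>\<^sup>+ z. ennreal (g z) \<partial>\<sigma>) < \<infinity>"
      using 1[of "space \<sigma>"] sets.top[of \<sigma>] \<sigma>(2) by simp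
  qed (use g in auto)
  moreover have "\<phi> (\<nu> E) = (LINT z:E|\<sigma>. g z)" if E: "E \<in> sets circle_borel" for E
    unfolding set_lebesgue_integral_def
    using g E \<sigma>(2) 1[OF E] nn[OF matrix_measure_nonneg[OF \<nu> E]]
    by (subst integral_eq_nn_integral) auto
  ultimately show ?thesis by blast
qed

text \<open>Polarisation writes this signed set function as a quarter of the difference of two
  non-negative ones, each of which has a scalar density.\<close>

lemma bilinear_density_exists:
  assumes \<nu>: "matrix_measure \<nu>"
    and \<sigma>: "finite_measure \<sigma>" "sets \<sigma> = sets circle_borel"
    and ac: "\<And>E. E \<in> null_sets \<sigma> \<Longrightarrow> \<nu> E = 0"
  shows "\<exists>g. integrable \<sigma> g \<and> (\<forall>E\<in>sets circle_borel. x \<bullet> (\<nu> E *v y) = (LINT z:E|\<sigma>. g z))"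
proof -
  have ex: "\<exists>g. integrable \<sigma> g \<and> (\<forall>E\<in>sets circle_borel. qform (\<nu> E) u = (LINT z:E|\<sigma>. g z))" for u
    by (intro scalar_density_exists \<nu> \<sigma> ac bounded_linear_inner_matrix_vector nonneg_matrix_qform)
  obtain g where g: "integrable \<sigma> g" "\<And>E. E \<in> sets circle_borel \<Longrightarrow> qform (\<nu> E) (x + y) = (LINT z:E|\<sigma>. g z)"
    using ex[of "x + y"] by blast
  obtain h where h: "integrable \<sigma> h" "\<And>E. E \<in> sets circle_borel \<Longrightarrow> qform (\<nu> E) (x - y) = (LINT z:E|\<sigma>. h z)"
    using ex[of "x - y"] by blast
  show ?thesis
  proof (intro exI conjI ballI)
    show "integrable \<sigma> (\<lambda>z. (1/4) * (g z - h z))" using g(1) h(1) by simp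
    fix E assume E: "E \<in> sets circle_borel"
    have sI: "set_integrable \<sigma> E f" if "integrable \<sigma> f" for f :: "complex \<Rightarrow> real"
      using that E \<sigma>(2) unfolding set_integrable_def by (intro integrable_mult_indicator) auto
    have "x \<bullet> (\<nu> E *v y) = (1/4) * (qform (\<nu> E) (x + y) - qform (\<nu> E) (x - y))"
      using nonneg_matrix_sym'[OF matrix_measure_nonneg[OF \<nu> E], of x y]
      by (simp add: matrix_vector_right_distrib matrix_vector_mult_diff_distrib inner_add_left
          inner_add_right inner_diff_left inner_diff_right)
    also have "\<dots> = (LINT z:E|\<sigma>. (1/4) * (g z - h z))"
      using E g h by (simp add: sI set_integral_diff)
    finally show "x \<bullet> (\<nu> E *v y) = (LINT z:E|\<sigma>. (1/4) * (g z - h z))" .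
  qed
qed

text \<open>Since coordinates are bilinear values, the scalar densities of the latter assemble into
  a matrix density.\<close>

lemma matrix_Basis_component:
  assumes "b \<in> (Basis :: (complex^'n^'n) set)"
  shows "\<exists>x y. \<forall>A. A \<bullet> b = x \<bullet> (A *v y)"
proof -
  obtain i j c where b: "b = axis i (axis j c)"
    using assms unfolding Basis_vec_def by auto
  have "(A *v axis j 1) $ i = A $ i $ j" for A :: "complex^'n^'n"
    by (simp add: matrix_vector_mult_def axis_def if_distrib cong: if_cong)
  then have "A \<bullet> b = axis i c \<bullet> (A *v axis j 1)" for A
    by (simp only: b inner_axis inner_axis') (simp add: inner_commute)
  then show ?thesis by blast
qed

text \<open>The reference measure is free, unlike in \<open>is_matrix_density\<close>, so that two
  matrix measures can be given densities with respect to a common one.\<close>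

definition has_matrix_density ::
    "complex measure \<Rightarrow> (complex set \<Rightarrow> complex^'n^'n) \<Rightarrow> (complex \<Rightarrow> complex^'n^'n) \<Rightarrow> bool" where
  "has_matrix_density \<sigma> \<nu> V \<longleftrightarrow> integrable \<sigma> V \<and> (\<forall>E\<in>sets circle_borel. \<nu> E = (LINT z:E|\<sigma>. V z))"

theorem matrix_Radon_Nikodym:
  fixes \<nu> :: "complex set \<Rightarrow> complex^'n^'n"
  assumes \<nu>: "matrix_measure \<nu>"
    and \<sigma>: "finite_measure \<sigma>" "sets \<sigma> = sets circle_borel"
    and ac: "\<And>E. E \<in> null_sets \<sigma> \<Longrightarrow> \<nu> E = 0"
  shows "\<exists>V. has_matrix_density \<sigma> \<nu> V"
proof -
  have "\<exists>g. integrable \<sigma> g \<and> (\<forall>E\<in>sets circle_borel. \<nu> E \<bullet> b = (LINT z:E|\<sigma>. g z))"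
    if b: "b \<in> Basis" for b
  proof -
    obtain x y where "\<And>A. A \<bullet> b = x \<bullet> (A *v y)" using matrix_Basis_component[OF b] by blast
    with bilinear_density_exists[OF \<nu> \<sigma> ac, of x y] show ?thesis by simp
  qed
  then obtain g where g: "\<And>b. b \<in> Basis \<Longrightarrow> integrable \<sigma> (g b)"
      "\<And>b E. b \<in> Basis \<Longrightarrow> E \<in> sets circle_borel \<Longrightarrow> \<nu> E \<bullet> b = (LINT z:E|\<sigma>. g b z)"
    by metis
  have "has_matrix_density \<sigma> \<nu> (\<lambda>z. \<Sum>b\<in>Basis. g b z *\<^sub>R b)"
    unfolding has_matrix_density_def
  proof (intro conjI ballI)
    show "integrable \<sigma> (\<lambda>z. \<Sum>b\<in>Basis. g b z *\<^sub>R b)" using g(1) by simp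
    fix E assume E: "E \<in> sets circle_borel"
    have "(LINT z:E|\<sigma>. (\<Sum>b\<in>Basis. g b z *\<^sub>R b)) = (LINT z|\<sigma>. (\<Sum>b\<in>Basis. (indicator E z *\<^sub>R g b z) *\<^sub>R b))"
      by (simp add: set_lebesgue_integral_def scaleR_sum_right)
    also have "\<dots> = (\<Sum>b\<in>Basis. LINT z|\<sigma>. (indicator E z *\<^sub>R g b z) *\<^sub>R b)"
      using E \<sigma>(2) g(1) by (intro Bochner_Integration.integral_sum integrable_scaleR_left integrable_mult_indicator) auto
    also have "\<dots> = (\<Sum>b\<in>Basis. (\<nu> E \<bullet> b) *\<^sub>R b)"
    proof (intro sum.cong refl)
      fix b :: "complex^'n^'n" assume b: "b \<in> Basis"
      have "integrable \<sigma> (\<lambda>z. indicator E z *\<^sub>R g b z)"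
        using E \<sigma>(2) g(1)[OF b] by (intro integrable_mult_indicator) auto
      then show "(LINT z|\<sigma>. (indicator E z *\<^sub>R g b z) *\<^sub>R b) = (\<nu> E \<bullet> b) *\<^sub>R b"
        unfolding g(2)[OF b E] set_lebesgue_integral_def by (intro integral_scaleR_left) simp
    qed
    finally show "\<nu> E = (LINT z:E|\<sigma>. (\<Sum>b\<in>Basis. g b z *\<^sub>R b))" by (simp add: euclidean_representation)
  qed
  then show ?thesis by blast
qed

lemma has_matrix_density_matrix_density:
  assumes \<nu>: "matrix_measure \<nu>"
  shows "has_matrix_density (trace_measure \<nu>) \<nu> (matrix_density \<nu>)"
proof -
  have "\<exists>V. is_matrix_density \<nu> V"
    using matrix_Radon_Nikodym[OF \<nu> finite_trace_measure[OF \<nu>] sets_trace_measure trace_measure_null[OF \<nu>]]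
    by (simp add: has_matrix_density_def is_matrix_density_def)
  then have "is_matrix_density \<nu> (matrix_density \<nu>)"
    unfolding matrix_density_def by (rule someI_ex)
  then show ?thesis by (simp add: has_matrix_density_def is_matrix_density_def)
qed

lemma has_matrix_densityD:
  assumes "has_matrix_density \<sigma> \<nu> V"
  shows "integrable \<sigma> V" "E \<in> sets circle_borel \<Longrightarrow> \<nu> E = (LINT z:E|\<sigma>. V z)"
  using assms by (auto simp: has_matrix_density_def)

lemma bounded_linear_density:
  fixes \<phi> :: "complex^'n^'n \<Rightarrow> 'b::{banach, second_countable_topology}"
  assumes V: "has_matrix_density \<sigma> \<nu> V" and \<phi>: "bounded_linear \<phi>"
    and \<sigma>: "sets \<sigma> = sets circle_borel" and E: "E \<in> sets circle_borel"
  shows "\<phi> (\<nu> E) = (LINT z:E|\<sigma>. \<phi> (V z))"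
proof -
  have "integrable \<sigma> (\<lambda>z. indicator E z *\<^sub>R V z)"
    using has_matrix_densityD(1)[OF V] E \<sigma> by (intro integrable_mult_indicator) auto
  then have "\<phi> (LINT z|\<sigma>. indicator E z *\<^sub>R V z) = (LINT z|\<sigma>. \<phi> (indicator E z *\<^sub>R V z))"
    by (rule integral_bounded_linear[OF \<phi>, symmetric])
  then show ?thesis
    using E by (simp add: has_matrix_densityD(2)[OF V] set_lebesgue_integral_def
        linear_cmul[OF bounded_linear.linear[OF \<phi>]])
qed

text \<open>The average of \<open>V\<close> over a set of positive measure is the value of
  \<open>\<nu>\<close> divided by that measure and lies in a closed set of matrices; the averaging
  theorem puts almost all values of \<open>V\<close> into the same set.\<close>

lemma matrix_density_AE:
  fixes \<nu> :: "complex set \<Rightarrow> complex^'n^'n"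
  assumes \<nu>: "matrix_measure \<nu>" and V: "has_matrix_density \<sigma> \<nu> V"
    and \<sigma>: "finite_measure \<sigma>" "sets \<sigma> = sets circle_borel"
    and le: "\<And>E. E \<in> sets circle_borel \<Longrightarrow> Re (trace (\<nu> E)) \<le> measure \<sigma> E"
  shows "AE z in \<sigma>. nonneg_matrix (V z) \<and> Re (trace (V z)) \<le> 1"
proof -
  interpret finite_measure \<sigma> by fact
  have "AE z in \<sigma>. V z \<in> {A. nonneg_matrix A} \<inter> {A. Re (trace A) \<le> 1}"
  proof (rule averaging_theorem)
    show "integrable \<sigma> V" by (rule has_matrix_densityD(1)[OF V])
    show "closed ({A :: complex^'n^'n. nonneg_matrix A} \<inter> {A. Re (trace A) \<le> 1})"
      by (intro closed_Int closed_nonneg_matrix closed_Collect_le continuous_intros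
          linear_continuous_on bounded_linear_Re_trace)
    fix A assume A: "A \<in> sets \<sigma>" and pos: "0 < measure \<sigma> A"
    then have "A \<in> sets circle_borel" by (simp add: \<sigma>)
    then have "nonneg_matrix (\<nu> A)" "Re (trace (\<nu> A)) \<le> measure \<sigma> A" "(LINT z:A|\<sigma>. V z) = \<nu> A"
      using matrix_measure_nonneg[OF \<nu>] le has_matrix_densityD(2)[OF V] by auto
    with pos show "(1 / measure \<sigma> A) *\<^sub>R (LINT z:A|\<sigma>. V z) \<in> {A. nonneg_matrix A} \<inter> {A. Re (trace A) \<le> 1}"
      using linear_cmul[OF bounded_linear.linear[OF bounded_linear_Re_trace], of "1 / measure \<sigma> A" "\<nu> A"]
      by (simp add: nonneg_matrix_scaleR del: linear_cmul)
  qed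
  then show ?thesis by simp
qed

lemma matrix_density_nonneg_AE:
  assumes \<nu>: "matrix_measure \<nu>"
  shows "AE z in trace_measure \<nu>. nonneg_matrix (matrix_density \<nu> z)"
  using matrix_density_AE[OF \<nu> has_matrix_density_matrix_density[OF \<nu>] finite_trace_measure[OF \<nu>]
      sets_trace_measure] measure_trace_measure[OF \<nu>]
  by (auto elim: eventually_mono)

lemma bounded_linear_congruence: "bounded_linear (\<lambda>A. cadjoint C ** A ** (C :: complex^'n^'n))"
  by (intro bounded_bilinear.bounded_linear_left[OF bounded_bilinear_matrix_mult, THEN bounded_linear_compose]
      bounded_bilinear.bounded_linear_right[OF bounded_bilinear_matrix_mult])

text \<open>A constant congruence is a linear map and leaves the integral, so the arbitrary choice
  in \<open>matrix_density\<close> drops out.\<close>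

lemma congruence_measure_const:
  assumes \<nu>: "matrix_measure \<nu>" and E: "E \<in> sets circle_borel"
  shows "congruence_measure (\<lambda>_. C) \<nu> E = cadjoint C ** \<nu> E ** C"
  using bounded_linear_density[OF has_matrix_density_matrix_density[OF \<nu>] bounded_linear_congruence
      sets_trace_measure E]
  by (simp add: congruence_measure_def)

lemma matrix_measure_congruence:
  assumes \<nu>: "matrix_measure \<nu>"
  shows "matrix_measure (congruence_measure (\<lambda>_. C) \<nu>)"
  unfolding matrix_measure_def
proof (intro conjI ballI allI impI)
  fix E assume "E \<in> sets circle_borel"
  then show "nonneg_matrix (congruence_measure (\<lambda>_. C) \<nu> E)"
    by (simp add: congruence_measure_const[OF \<nu>] nonneg_matrix_congruence matrix_measure_nonneg[OF \<nu>])
next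
  fix A :: "nat \<Rightarrow> complex set" assume A: "range A \<subseteq> sets circle_borel" "disjoint_family A"
  then have "A i \<in> sets circle_borel" "(\<Union>i. A i) \<in> sets circle_borel" for i by auto
  then show "(\<lambda>i. congruence_measure (\<lambda>_. C) \<nu> (A i)) sums congruence_measure (\<lambda>_. C) \<nu> (\<Union>i. A i)"
    using bounded_linear.sums[OF bounded_linear_congruence matrix_measure_sums[OF \<nu> A]]
    by (simp add: congruence_measure_const[OF \<nu>])
qed

section \<open>The Lebesgue decomposition of a matrix measure\<close>

lemma sets_circle_lebesgue [simp]: "sets circle_lebesgue = sets circle_borel"
  by (simp add: circle_lebesgue_def)

lemma matrix_measure_restrict:
  assumes \<nu>: "matrix_measure \<nu>" and N: "N \<in> sets circle_borel"
  shows "matrix_measure (\<lambda>E. \<nu> (E \<inter> N))" "matrix_measure (\<lambda>E. \<nu> (E - N))"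
proof -
  have "(\<lambda>i. \<nu> (A i \<inter> N)) sums \<nu> ((\<Union>i. A i) \<inter> N)" "(\<lambda>i. \<nu> (A i - N)) sums \<nu> ((\<Union>i. A i) - N)"
    if A: "range A \<subseteq> sets circle_borel" "disjoint_family A" for A :: "nat \<Rightarrow> complex set"
  proof -
    have "range (\<lambda>i. A i \<inter> N) \<subseteq> sets circle_borel" "range (\<lambda>i. A i - N) \<subseteq> sets circle_borel"
      using A(1) N by auto
    moreover have "disjoint_family (\<lambda>i. A i \<inter> N)" "disjoint_family (\<lambda>i. A i - N)"
      using A(2) by (auto simp: disjoint_family_on_def)
    moreover have "(\<Union>i. A i \<inter> N) = (\<Union>i. A i) \<inter> N" "(\<Union>i. A i - N) = (\<Union>i. A i) - N" by auto
    ultimately show "(\<lambda>i. \<nu> (A i \<inter> N)) sums \<nu> ((\<Union>i. A i) \<inter> N)" "(\<lambda>i. \<nu> (A i - N)) sums \<nu> ((\<Union>i. A i) - N)"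
      using matrix_measure_sums[OF \<nu>, of "\<lambda>i. A i \<inter> N"] matrix_measure_sums[OF \<nu>, of "\<lambda>i. A i - N"]
      by simp_all
  qed
  then show "matrix_measure (\<lambda>E. \<nu> (E \<inter> N))" "matrix_measure (\<lambda>E. \<nu> (E - N))"
    using N by (simp_all add: matrix_measure_def matrix_measure_nonneg[OF \<nu>])
qed

text \<open>Exhaustion: some Lebesgue null set \<open>M\<close> has the largest trace mass. A null
  set disjoint from \<open>M\<close> carries nothing, since its union with \<open>M\<close> would
  exceed the maximum; so the part on \<open>M\<close> is singular and the rest absolutely
  continuous.\<close>

lemma lebesgue_decomposition_exists:
  assumes \<nu>: "matrix_measure \<nu>"
  shows "\<exists>\<nu>s \<nu>a. lebesgue_decomposition \<nu> \<nu>a \<nu>s"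
proof -
  interpret finite_measure "trace_measure \<nu>" by (rule finite_trace_measure[OF \<nu>])
  let ?m = "measure (trace_measure \<nu>)"
  let ?Z = "null_sets circle_lebesgue"
  have ZC: "E \<in> sets circle_borel" if "E \<in> ?Z" for E
    using that by (metis null_setsD2 sets_circle_lebesgue)
  define s where "s = Sup (?m ` ?Z)"
  have bdd: "bdd_above (?m ` ?Z)"
    by (intro bdd_aboveI[of _ "?m (space (trace_measure \<nu>))"]) (auto intro: bounded_measure simp del: space_trace_measure)
  have ne: "?m ` ?Z \<noteq> {}" using null_sets.empty_sets by blast
  have "\<exists>N\<in>?Z. s - 1 / Suc k < ?m N" for k :: nat
    using less_cSup_iff[OF ne bdd, of "s - 1 / Suc k"] by (auto simp: s_def)
  then obtain N where N: "\<And>k. N k \<in> ?Z" "\<And>k::nat. s - 1 / Suc k < ?m (N k)" by metis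
  define M where "M = (\<Union>k. N k)"
  have MZ: "M \<in> ?Z" unfolding M_def using N(1) by (intro null_sets_UN) auto
  have "s \<le> ?m M"
  proof (rule field_le_epsilon)
    fix e :: real assume "0 < e"
    then obtain k :: nat where "1 / Suc k < e" using nat_approx_posE by blast
    moreover have "?m (N k) \<le> ?m M"
      using N(1) ZC[OF MZ] by (intro finite_measure_mono) (auto simp: M_def)
    ultimately show "s \<le> ?m M + e" using N(2)[of k] by linarith
  qed
  have ac: "\<nu> (E - M) = 0" if E: "E \<in> ?Z" for E
  proof (rule trace_measure_null[OF \<nu>])
    have "?m (M \<union> (E - M)) \<le> s"
      unfolding s_def using E MZ by (intro cSup_upper bdd imageI) auto
    moreover have "?m (M \<union> (E - M)) = ?m M + ?m (E - M)"
      using ZC[OF E] ZC[OF MZ] by (intro finite_measure_Union) auto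
    ultimately have "?m (E - M) = 0" using \<open>s \<le> ?m M\<close> measure_nonneg[of "trace_measure \<nu>" "E - M"] by linarith
    then show "E - M \<in> null_sets (trace_measure \<nu>)"
      using ZC[OF E] ZC[OF MZ] by (intro null_setsI) (auto simp: emeasure_eq_measure)
  qed
  have "lebesgue_decomposition \<nu> (\<lambda>E. \<nu> (E - M)) (\<lambda>E. \<nu> (E \<inter> M))"
    unfolding lebesgue_decomposition_def
  proof (intro conjI ballI bexI[OF _ MZ] matrix_measure_restrict \<nu> ZC MZ)
    fix E assume E: "E \<in> sets circle_borel"
    have "(E - M) \<union> (E \<inter> M) = E" "(E - M) \<inter> (E \<inter> M) = {}" by auto
    then show "\<nu> E = \<nu> (E - M) + \<nu> (E \<inter> M)"
      using matrix_measure_Un[OF \<nu>, of "E - M" "E \<inter> M"] E ZC[OF MZ] by simp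
    have "(E - M) \<inter> M = {}" by auto
    then show "\<nu> ((E - M) \<inter> M) = 0"
      by (simp only: matrix_measure_empty[OF \<nu>])
  qed (use ac in auto)
  then show ?thesis by blast
qed

lemma singular_part_decomposition:
  "matrix_measure \<nu> \<Longrightarrow> \<exists>\<nu>a. lebesgue_decomposition \<nu> \<nu>a (singular_part \<nu>)"
  unfolding singular_part_def by (rule someI_ex[OF lebesgue_decomposition_exists])

text \<open>These properties hold whichever decomposition the choice operator picks; domination by
  \<open>\<nu>\<close> comes from the non-negativity of the absolutely continuous part.\<close>

lemma singular_part:
  assumes \<nu>: "matrix_measure \<nu>"
  shows "matrix_measure (singular_part \<nu>)"
    and "E \<in> sets circle_borel \<Longrightarrow> qform (singular_part \<nu> E) x \<le> qform (\<nu> E) x"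
    and "\<exists>N\<in>null_sets circle_lebesgue. \<forall>E\<in>sets circle_borel. singular_part \<nu> (E - N) = 0"
proof -
  obtain \<nu>a where d: "lebesgue_decomposition \<nu> \<nu>a (singular_part \<nu>)"
    using singular_part_decomposition[OF \<nu>] by blast
  then show "matrix_measure (singular_part \<nu>)"
    and "\<exists>N\<in>null_sets circle_lebesgue. \<forall>E\<in>sets circle_borel. singular_part \<nu> (E - N) = 0"
    by (simp_all add: lebesgue_decomposition_def)
  assume E: "E \<in> sets circle_borel"
  then have "\<nu> E = \<nu>a E + singular_part \<nu> E" "nonneg_matrix (\<nu>a E)"
    using d by (auto simp: lebesgue_decomposition_def matrix_measure_nonneg)
  then show "qform (singular_part \<nu> E) x \<le> qform (\<nu> E) x"
    by (simp add: matrix_vector_mult_add_rdistrib inner_add_right nonneg_matrix_qform)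
qed

section \<open>A criterion for vector mutual singularity\<close>

lemma cis_measurable [measurable]: "cis \<in> borel \<rightarrow>\<^sub>M circle_borel"
  by (intro measurable_restrict_space2 borel_measurable_continuous_onI continuous_intros) auto

lemma arc_in_sets: "cis ` {a..b} \<in> sets circle_borel"
proof -
  have "closed (cis ` {a..b})"
    by (intro compact_imp_closed compact_continuous_image continuous_intros) auto
  then show ?thesis by (auto simp: sets_restrict_space_iff)
qed

text \<open>Passing to angles makes coverings by intervals of small total length available.\<close>

lemma circle_null_negligible:
  assumes "F \<in> null_sets circle_lebesgue"
  shows "negligible ({0..<2*pi} \<inter> cis -` F)"
proof -
  have F: "F \<in> sets circle_borel" "emeasure circle_lebesgue F = 0"
    using assms by (auto simp: null_sets_def)
  have m: "cis -` F \<in> sets borel"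
    using measurable_sets[OF cis_measurable F(1)] by simp
  have "emeasure (uniform_measure lborel {0..<2*pi}) (cis -` F) = 0"
    using F m by (simp add: circle_lebesgue_def emeasure_distr)
  then have "emeasure lborel ({0..<2*pi} \<inter> cis -` F) = 0"
    using m by (simp add: ennreal_divide_eq_0_iff)
  moreover have "{0..<2*pi} \<inter> cis -` F \<in> sets lborel" using m by simp
  ultimately have "{0..<2*pi} \<inter> cis -` F \<in> null_sets lborel" by blast
  then show ?thesis
    by (metis negligible_iff_null_sets null_sets_completionI)
qed

lemma sphere_eq_cis:
  assumes "norm z = 1"
  obtains t where "0 \<le> t" "t < 2*pi" "z = cis t"
proof
  show "z = cis (Arg2pi z)" using Arg2pi_eq[of z] assms by (simp add: cis_conv_exp)
qed (simp_all add: Arg2pi_ge_0 Arg2pi_lt_2pi)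

text \<open>The mass is subadditive, while length is additive here: non-overlapping intervals meet
  in negligible sets.\<close>

lemma measure_Union_intervals_le:
  assumes \<D>: "finite \<D>" "\<And>K. K \<in> \<D> \<Longrightarrow> \<exists>c d::real. K = {c..d} \<and> c < d"
    and dis: "pairwise (\<lambda>A B. interior A \<inter> interior B = {}) \<D>"
    and fin: "finite_measure \<sigma>"
    and sets: "\<And>K. K \<in> \<D> \<Longrightarrow> G K \<in> sets \<sigma>"
    and le: "\<And>K. K \<in> \<D> \<Longrightarrow> measure \<sigma> (G K) \<le> C * measure lebesgue K"
  shows "measure \<sigma> (\<Union>K\<in>\<D>. G K) \<le> C * measure lebesgue (\<Union>\<D>)"
proof -
  interpret finite_measure \<sigma> by fact
  have neg: "pairwise (\<lambda>S T. negligible (S \<inter> T)) \<D>"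
  proof (rule pairwiseI)
    fix S T assume ST: "S \<in> \<D>" "T \<in> \<D>" "S \<noteq> T"
    then have "convex (S \<inter> T)" using \<D>(2)[of S] \<D>(2)[of T] by (auto intro!: convex_Int)
    moreover have "interior (S \<inter> T) = {}" using dis ST by (simp add: pairwise_def)
    ultimately show "negligible (S \<inter> T)" by (simp add: negligible_convex_interior)
  qed
  have "measure \<sigma> (\<Union>K\<in>\<D>. G K) \<le> (\<Sum>K\<in>\<D>. measure \<sigma> (G K))"
    using \<D>(1) sets by (intro finite_measure_subadditive_finite) auto
  also have "\<dots> \<le> (\<Sum>K\<in>\<D>. C * measure lebesgue K)" by (intro sum_mono le)
  also have "\<dots> = C * measure lebesgue (\<Union>\<D>)"
    using measure_negligible_finite_Union[OF \<D>(1) _ neg] \<D>(2)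
    by (fastforce simp: sum_distrib_left)
  finally show ?thesis .
qed

text \<open>The angles of \<open>F\<close> are covered by non-overlapping intervals of total length
  at most \<open>e\<close>, and the bound on arcs then gives mass at most \<open>C * e\<close>, for
  every positive \<open>e\<close>.\<close>

lemma null_set_of_arc_bound:
  assumes fin: "finite_measure \<sigma>" and sets: "sets \<sigma> = sets circle_borel"
    and F: "F \<in> null_sets circle_lebesgue" and C: "0 \<le> C"
    and le: "\<And>a b. 0 \<le> a \<Longrightarrow> a < b \<Longrightarrow> b \<le> 2*pi \<Longrightarrow> measure \<sigma> (F \<inter> cis ` {a..b}) \<le> C * (b - a)"
  shows "F \<in> null_sets \<sigma>"
proof -
  interpret finite_measure \<sigma> by fact
  have FC: "F \<in> sets circle_borel" using F by (metis null_setsD2 sets_circle_lebesgue)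
  have Fsub: "F \<subseteq> sphere 0 1" using sets.sets_into_space[OF FC] by simp
  define S where "S = {0..<2*pi} \<inter> cis -` F"
  have S: "negligible S" unfolding S_def by (rule circle_null_negligible[OF F])
  have "measure \<sigma> F \<le> C * e" if e: "0 < e" for e
  proof -
    obtain \<D> where \<D>: "countable \<D>"
        "\<And>K. K \<in> \<D> \<Longrightarrow> K \<subseteq> cbox 0 (2*pi) \<and> K \<noteq> {} \<and> (\<exists>c d. K = cbox c d)"
        "pairwise (\<lambda>A B. interior A \<inter> interior B = {}) \<D>"
        "\<And>K. \<lbrakk>K \<in> \<D>; box 0 (2*pi) \<noteq> {}\<rbrakk> \<Longrightarrow> interior K \<noteq> {}"
        "S \<subseteq> \<Union>\<D>" "\<Union>\<D> \<in> lmeasurable" "measure lebesgue (\<Union>\<D>) \<le> measure lebesgue S + e"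
    proof (rule measurable_outer_intervals_bounded[of S 0 "2*pi" e])
      show "S \<in> lmeasurable" using S negligible_iff_measure by blast
      show "S \<subseteq> cbox 0 (2*pi)" by (auto simp: S_def)
    qed (use e in auto)
    have int: "\<exists>c d. K = {c..d} \<and> c < d \<and> 0 \<le> c \<and> d \<le> 2*pi" if K: "K \<in> \<D>" for K
    proof -
      obtain c d where cd: "K = cbox c d" using \<D>(2)[OF K] by blast
      \<comment> \<open>Degenerate intervals must be excluded, as the bound on arcs is assumed for
        \<open>a < b\<close>.\<close>
      have "interior K \<noteq> {}" using \<D>(4)[OF K] pi_gt_zero by auto
      then have "c < d" by (simp add: cd)
      then show ?thesis using \<D>(2)[OF K] cd by auto
    qed
    define G where "G = (\<lambda>K. F \<inter> cis ` K)"
    have Gm: "G K \<in> sets \<sigma>" if "K \<in> \<D>" for K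
      using int[OF that] FC arc_in_sets by (auto simp: G_def sets)
    have Gle: "measure \<sigma> (G K) \<le> C * measure lebesgue K" if "K \<in> \<D>" for K
      using int[OF that] le by (auto simp: G_def)
    have cover: "F \<subseteq> (\<Union>K\<in>\<D>. G K)"
    proof
      fix z assume z: "z \<in> F"
      then have "norm z = 1" using Fsub by auto
      then obtain t where "0 \<le> t" "t < 2*pi" "z = cis t"
        by (rule sphere_eq_cis)
      then have "t \<in> S" using z by (auto simp: S_def)
      then show "z \<in> (\<Union>K\<in>\<D>. G K)" using \<D>(5) z \<open>z = cis t\<close> by (auto simp: G_def)
    qed
    \<comment> \<open>The cover may be infinite; its finite stages increase to it, and the bound
      passes to the limit.\<close>
    define \<D>n where "\<D>n = (\<lambda>n. from_nat_into \<D> ` {..<n::nat})"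
    show ?thesis
    proof (cases "\<D> = {}")
      case True
      then show ?thesis using cover C e by simp
    next
      case False
      have sub: "\<D>n n \<subseteq> \<D>" for n unfolding \<D>n_def using from_nat_into[OF False] by blast
      have Un: "(\<Union>n. \<D>n n) = \<D>"
        using range_from_nat_into[OF False \<D>(1)] by (auto simp: \<D>n_def) blast
      have "(\<lambda>n. measure \<sigma> (\<Union>K\<in>\<D>n n. G K)) \<longlonglongrightarrow> measure \<sigma> (\<Union>n. \<Union>K\<in>\<D>n n. G K)"
      proof (rule finite_Lim_measure_incseq)
        show "range (\<lambda>n. \<Union>K\<in>\<D>n n. G K) \<subseteq> sets \<sigma>"
          using Gm sub by (auto simp: \<D>n_def intro!: sets.finite_UN)
        show "incseq (\<lambda>n. \<Union>K\<in>\<D>n n. G K)"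
          by (rule incseq_SucI) (auto simp: \<D>n_def lessThan_Suc)
      qed
      moreover have "measure \<sigma> (\<Union>K\<in>\<D>n n. G K) \<le> C * e" for n
      proof -
        have "measure \<sigma> (\<Union>K\<in>\<D>n n. G K) \<le> C * measure lebesgue (\<Union>(\<D>n n))"
        proof (rule measure_Union_intervals_le[OF _ _ _ fin])
          show "finite (\<D>n n)" by (simp add: \<D>n_def)
          show "pairwise (\<lambda>A B. interior A \<inter> interior B = {}) (\<D>n n)"
            by (rule pairwise_subset[OF \<D>(3) sub])
        next
          fix K assume "K \<in> \<D>n n"
          then have K: "K \<in> \<D>" using sub by blast
          show "\<exists>c d. K = {c..d} \<and> c < d" using int[OF K] by blast
          show "G K \<in> sets \<sigma>" by (rule Gm[OF K])
          show "measure \<sigma> (G K) \<le> C * measure lebesgue K" by (rule Gle[OF K])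
        qed
        also have "measure lebesgue (\<Union>(\<D>n n)) \<le> measure lebesgue (\<Union>\<D>)"
        proof (rule measure_mono_fmeasurable[OF _ _ \<D>(6)])
          have "K \<in> sets lebesgue" if "K \<in> \<D>n n" for K
          proof -
            have "K \<in> \<D>" using sub that by blast
            then obtain c d where "K = {c..d}" using int by blast
            then show ?thesis by simp
          qed
          then show "\<Union>(\<D>n n) \<in> sets lebesgue"
            by (intro sets.finite_Union) (auto simp: \<D>n_def)
        qed (use sub in blast)
        also have "\<dots> \<le> e" using \<D>(7) S by (simp add: negligible_iff_measure)
        finally show ?thesis using C by (simp add: mult_left_mono)
      qed
      ultimately have "measure \<sigma> (\<Union>n. \<Union>K\<in>\<D>n n. G K) \<le> C * e"
        by (intro LIMSEQ_le_const2) auto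
      moreover have "(\<Union>n. \<Union>K\<in>\<D>n n. G K) = (\<Union>K\<in>\<D>. G K)" using Un by blast
      moreover have "(\<Union>K\<in>\<D>. G K) = F" using cover by (auto simp: G_def)
      ultimately show ?thesis by simp
    qed
  qed
  note small = this
  have "measure \<sigma> F \<le> 0 + e" if e: "0 < e" for e
  proof -
    \<comment> \<open>Dividing by \<open>C + 1\<close> covers the case \<open>C = 0\<close>.\<close>
    have "measure \<sigma> F \<le> C * (e / (C + 1))" using C e by (intro small) simp
    also have "\<dots> \<le> e" using C e by (simp add: field_simps)
    finally show ?thesis by simp
  qed
  then have "measure \<sigma> F \<le> 0" by (rule field_le_epsilon)
  then have "measure \<sigma> F = 0" using measure_nonneg[of \<sigma> F] by linarith
  then show ?thesis using FC by (simp add: null_sets_def sets emeasure_eq_measure)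
qed

text \<open>The average of \<open>W\<close> over \<open>E\<close> is as close to \<open>A\<close> as
  its values are; multiplied by the measure of \<open>E\<close>, the estimate also makes sense on
  null sets.\<close>

lemma norm_integral_diff_le:
  fixes W :: "complex \<Rightarrow> 'b::{banach, second_countable_topology}"
  assumes fin: "finite_measure \<sigma>" and W: "integrable \<sigma> W" and E: "E \<in> sets \<sigma>"
    and le: "\<And>z. z \<in> E \<Longrightarrow> dist A (W z) \<le> d"
  shows "norm ((LINT z:E|\<sigma>. W z) - measure \<sigma> E *\<^sub>R A) \<le> d * measure \<sigma> E"
proof -
  interpret finite_measure \<sigma> by fact
  have ii: "integrable \<sigma> (indicat_real E)"
    using E by (intro integrable_real_indicator) (simp_all add: less_top[symmetric])
  have 1: "integrable \<sigma> (\<lambda>z. indicator E z *\<^sub>R W z)" "integrable \<sigma> (\<lambda>z. indicator E z *\<^sub>R A)"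
    using E W by (auto intro!: integrable_mult_indicator)
  have "(LINT z|\<sigma>. indicator E z *\<^sub>R A) = measure \<sigma> E *\<^sub>R A"
    using E ii by (subst integral_scaleR_left) auto
  then have "(LINT z:E|\<sigma>. W z) - measure \<sigma> E *\<^sub>R A = (LINT z|\<sigma>. indicator E z *\<^sub>R W z - indicator E z *\<^sub>R A)"
    by (simp add: set_lebesgue_integral_def Bochner_Integration.integral_diff[OF 1])
  also have "norm \<dots> \<le> (LINT z|\<sigma>. norm (indicator E z *\<^sub>R W z - indicator E z *\<^sub>R A))"
    by (rule integral_norm_bound)
  also have "\<dots> \<le> (LINT z|\<sigma>. d * indicator E z)"
  proof (rule integral_mono)
    show "integrable \<sigma> (\<lambda>z. d * indicator E z)" using ii by simp
    fix z show "norm (indicator E z *\<^sub>R W z - indicator E z *\<^sub>R A) \<le> d * indicator E z"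
      using le[of z] by (auto simp: indicator_def dist_norm norm_minus_commute)
  qed (use 1 in auto)
  also have "\<dots> = d * measure \<sigma> E" using E by simp
  finally show ?thesis .
qed

text \<open>\<open>congruence_measure\<close> is built on the trace measure and its chosen density.
  Both are recovered from \<open>\<sigma>\<close> and \<open>W\<close>: the trace measure has
  density \<open>?t\<close> with respect to \<open>\<sigma>\<close>, and \<open>?t\<close> times the
  chosen density is \<open>W\<close> almost everywhere.\<close>

lemma congruence_measure_eq_0:
  assumes \<nu>: "matrix_measure \<nu>" and W: "has_matrix_density \<sigma> \<nu> W"
    and \<sigma>: "finite_measure \<sigma>" "sets \<sigma> = sets circle_borel"
    and nn: "AE z in \<sigma>. nonneg_matrix (W z)"
    and Q: "AE z in \<sigma>. cadjoint (Q z) ** W z ** Q z = 0"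
  shows "congruence_measure Q \<nu> E = 0"
proof -
  interpret finite_measure \<sigma> by fact
  let ?t = "\<lambda>z. Re (trace (W z))" and ?V = "matrix_density \<nu>"
  note tr = bounded_linear_Re_trace
  have Wi: "integrable \<sigma> W" by (rule has_matrix_densityD(1)[OF W])
  have ti: "integrable \<sigma> ?t" by (rule integrable_bounded_linear[OF tr Wi])
  have t0: "AE z in \<sigma>. 0 \<le> ?t z" using nn by (auto elim: eventually_mono simp: trace_nonneg)
  have \<tau>: "trace_measure \<nu> = density \<sigma> ?t"
  proof (rule measure_eqI)
    fix A assume "A \<in> sets (trace_measure \<nu>)"
    then have A: "A \<in> sets circle_borel" by simp
    have "emeasure (density \<sigma> ?t) A = (\<integral>\<^sup>+ z. ennreal (?t z) * indicator A z \<partial>\<sigma>)"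
      using A \<sigma>(2) ti by (intro emeasure_density) auto
    also have "\<dots> = (\<integral>\<^sup>+ z. ennreal (indicator A z *\<^sub>R ?t z) \<partial>\<sigma>)"
      by (intro nn_integral_cong) (auto simp: indicator_def)
    also have "\<dots> = ennreal (LINT z:A|\<sigma>. ?t z)"
      unfolding set_lebesgue_integral_def
      using A \<sigma>(2) ti t0
      by (intro nn_integral_eq_integral integrable_mult_indicator) (auto elim!: eventually_mono)
    also have "(LINT z:A|\<sigma>. ?t z) = Re (trace (\<nu> A))"
      by (rule bounded_linear_density[OF W tr \<sigma>(2) A, symmetric])
    finally show "emeasure (trace_measure \<nu>) A = emeasure (density \<sigma> ?t) A"
      by (simp add: emeasure_trace_measure[OF \<nu> A])
  qed (simp add: \<sigma>)
  note V = has_matrix_density_matrix_density[OF \<nu>]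
  have Vm: "?V \<in> borel_measurable \<sigma>"
    using borel_measurable_integrable[OF has_matrix_densityD(1)[OF V]]
    by (simp add: \<sigma>(2) cong: measurable_cong_sets)
  have tm: "?t \<in> borel_measurable \<sigma>" using ti by simp
  have int: "integrable \<sigma> (\<lambda>z. ?t z *\<^sub>R ?V z)"
    using has_matrix_densityD(1)[OF V] integrable_density[OF Vm tm t0] by (simp add: \<tau>)
  have "AE z in \<sigma>. ?t z *\<^sub>R ?V z = W z"
  proof (rule density_unique_banach[OF int Wi])
    fix A assume A: "A \<in> sets \<sigma>"
    then have A': "A \<in> sets circle_borel" by (simp add: \<sigma>)
    have "(LINT z:A|\<sigma>. W z) = \<nu> A" using has_matrix_densityD(2)[OF W A'] by simp
    also have "\<dots> = (LINT z|density \<sigma> ?t. indicator A z *\<^sub>R ?V z)"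
      using has_matrix_densityD(2)[OF V A'] by (simp add: \<tau> set_lebesgue_integral_def)
    also have "\<dots> = (LINT z|\<sigma>. ?t z *\<^sub>R (indicator A z *\<^sub>R ?V z))"
      using A Vm tm t0 by (intro integral_density) auto
    also have "\<dots> = (LINT z:A|\<sigma>. ?t z *\<^sub>R ?V z)"
      by (simp add: set_lebesgue_integral_def mult.commute)
    finally show "(LINT z:A|\<sigma>. ?t z *\<^sub>R ?V z) = (LINT z:A|\<sigma>. W z)" by simp
  qed
  \<comment> \<open>Where the trace is positive it cancels; where it vanishes, the trace measure has
    no mass.\<close>
  with Q have "AE z in \<sigma>. 0 < ennreal (?t z) \<longrightarrow> cadjoint (Q z) ** ?V z ** Q z = 0"
  proof eventually_elim
    case (elim z)
    have "?t z *\<^sub>R (cadjoint (Q z) ** ?V z ** Q z) = cadjoint (Q z) ** (?t z *\<^sub>R ?V z) ** Q z"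
      by (simp only: scaleR_matrix_mult matrix_mult_scaleR)
    also have "\<dots> = 0" by (simp only: elim)
    finally show ?case by auto
  qed
  then have "AE z in trace_measure \<nu>. cadjoint (Q z) ** ?V z ** Q z = 0"
    using tm by (subst \<tau>, subst AE_density) auto
  then show ?thesis
    unfolding congruence_measure_def set_lebesgue_integral_def
    by (intro integral_eq_zero_AE) (auto elim: eventually_mono)
qed

text \<open>If the product is non-zero at a pair of matrices, one of its bilinear values stays away
  from 0 near that pair. Where the densities stay near the pair, so do their averages, and the
  assumed bound makes the mass on an arc at most proportional to its length. A Lebesgue null set of
  this kind has no mass.\<close>

lemma density_product_eq_0:
  fixes \<nu>1 \<nu>2 :: "complex set \<Rightarrow> complex^'n^'n"
  assumes \<nu>1: "matrix_measure \<nu>1" and \<nu>2: "matrix_measure \<nu>2"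
    and W1: "has_matrix_density \<sigma> \<nu>1 W1" and W2: "has_matrix_density \<sigma> \<nu>2 W2"
    and \<sigma>: "finite_measure \<sigma>" "sets \<sigma> = sets circle_borel"
    and tr1: "\<And>E. E \<in> sets circle_borel \<Longrightarrow> Re (trace (\<nu>1 E)) \<le> measure \<sigma> E"
    and tr2: "\<And>E. E \<in> sets circle_borel \<Longrightarrow> Re (trace (\<nu>2 E)) \<le> measure \<sigma> E"
    and N: "N \<in> null_sets circle_lebesgue" "sphere 0 1 - N \<in> null_sets \<sigma>"
    and K: "0 \<le> K"
    and le: "\<And>a b E v. 0 \<le> a \<Longrightarrow> a < b \<Longrightarrow> b \<le> 2*pi \<Longrightarrow> E \<in> sets circle_borel \<Longrightarrow>
       E \<subseteq> cis ` {a..b} \<Longrightarrow> qform (\<nu>2 E) (\<nu>1 E *v v) \<le> K * (b - a)\<^sup>2 * qform (\<nu>1 E) v"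
  shows "AE z in \<sigma>. W2 z ** W1 z = 0"
proof -
  interpret finite_measure \<sigma> by fact
  have sp: "space \<sigma> = sphere 0 1" using sets_eq_imp_space_eq[OF \<sigma>(2)] by simp
  have NC: "N \<in> sets circle_borel" using N by (metis null_setsD2 sets_circle_lebesgue)
  have [measurable]: "W1 \<in> borel_measurable \<sigma>" "W2 \<in> borel_measurable \<sigma>"
    using W1 W2 by (auto dest: has_matrix_densityD(1))
  define Z where "Z = (\<lambda>U. {z \<in> space \<sigma>. (W1 z, W2 z) \<in> U})"
  have local: "\<exists>U. open U \<and> (A, B) \<in> U \<and> Z U \<in> null_sets \<sigma>" if AB: "B ** A \<noteq> 0" for A B
  proof -
    obtain v w where vw: "v \<bullet> (B *v (A *v w)) \<noteq> 0"
      using matrix_eqI_inner[of "B ** A" 0] AB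
      by (auto simp: matrix_vector_mul_assoc)
    define f where "f = (\<lambda>p :: (complex^'n^'n) \<times> (complex^'n^'n). v \<bullet> ((snd p ** fst p) *v w))"
    define c where "c = \<bar>f (A, B)\<bar> / 2"
    have c: "0 < c" using vw by (simp add: c_def f_def matrix_vector_mul_assoc)
    have "continuous_on UNIV (\<lambda>p :: (complex^'n^'n) \<times> (complex^'n^'n). snd p ** fst p)"
      by (intro bounded_bilinear.continuous_on[OF bounded_bilinear_matrix_mult] continuous_intros)
    then have "continuous_on UNIV f"
      unfolding f_def by (rule bounded_linear.continuous_on[OF bounded_linear_inner_matrix_vector])
    then have "open {p. c < \<bar>f p\<bar>}"
      by (rule open_Collect_less[OF continuous_on_const continuous_on_rabs])
    moreover have "(A, B) \<in> {p. c < \<bar>f p\<bar>}" using c by (simp add: c_def)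
    ultimately obtain P Q where PQ: "open P" "open Q" "(A, B) \<in> P \<times> Q" "P \<times> Q \<subseteq> {p. c < \<bar>f p\<bar>}"
      by (rule open_prod_elim)
    then have "A \<in> P" "B \<in> Q" by auto
    \<comment> \<open>Closed balls, because averages of values in the open balls of \<open>U\<close>
      are only estimated to lie in the closed ones.\<close>
    obtain d1 where d1: "0 < d1" "cball A d1 \<subseteq> P" using PQ(1) \<open>A \<in> P\<close> open_contains_cball by metis
    obtain d2 where d2: "0 < d2" "cball B d2 \<subseteq> Q" using PQ(2) \<open>B \<in> Q\<close> open_contains_cball by metis
    have far: "c < \<bar>v \<bullet> (B' *v (A' *v w))\<bar>" if "dist A A' \<le> d1" "dist B B' \<le> d2" for A' B'
    proof -
      have "(A', B') \<in> P \<times> Q" using d1 d2 that by auto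
      then show ?thesis using PQ(4) by (auto simp: f_def matrix_vector_mul_assoc)
    qed
    define U where "U = ball A d1 \<times> ball B d2"
    define F where "F = Z U \<inter> N"
    have U: "open U" "(A, B) \<in> U" using d1 d2 by (auto simp: U_def open_Times)
    have Zm: "Z U \<in> sets \<sigma>" unfolding Z_def U_def mem_Sigma_iff mem_ball by measurable
    have Fnull: "F \<in> null_sets circle_lebesgue"
      using N(1) Zm by (simp add: F_def \<sigma>(2) null_set_Int1)
    \<comment> \<open>Read off from the estimate below: \<open>c * s\<^sup>2\<close> is at most
      \<open>sqrt K * norm v * norm w * (b - a) * s\<close>, and one factor \<open>s\<close>
      cancels.\<close>
    define C where "C = sqrt K * norm v * norm w / c"
    have "F \<in> null_sets \<sigma>"
    proof (rule null_set_of_arc_bound[OF \<sigma> Fnull])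
      show "0 \<le> C" using c K by (simp add: C_def)
      fix a b :: real assume ab: "0 \<le> a" "a < b" "b \<le> 2*pi"
      define E where "E = F \<inter> cis ` {a..b}"
      have E: "E \<in> sets circle_borel" using Fnull arc_in_sets by (auto simp: E_def dest!: null_setsD2)
      then have E\<sigma>: "E \<in> sets \<sigma>" by (simp add: \<sigma>)
      define s where "s = measure \<sigma> E"
      have "s \<le> C * (b - a)"
      proof (cases "s = 0")
        case True
        then show ?thesis using \<open>0 \<le> C\<close> ab by simp
      next
        case False
        then have s: "0 < s" by (simp add: s_def zero_less_measure_iff)
        define A' B' where "A' = (1 / s) *\<^sub>R \<nu>1 E" and "B' = (1 / s) *\<^sub>R \<nu>2 E"
        have \<nu>E: "\<nu>1 E = s *\<^sub>R A'" "\<nu>2 E = s *\<^sub>R B'" using s by (simp_all add: A'_def B'_def)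
        have n1: "norm (\<nu>1 E - s *\<^sub>R A) \<le> d1 * s"
          unfolding has_matrix_densityD(2)[OF W1 E] s_def
          by (rule norm_integral_diff_le[OF \<sigma>(1) has_matrix_densityD(1)[OF W1] E\<sigma>])
             (auto simp: E_def F_def Z_def U_def)
        have n2: "norm (\<nu>2 E - s *\<^sub>R B) \<le> d2 * s"
          unfolding has_matrix_densityD(2)[OF W2 E] s_def
          by (rule norm_integral_diff_le[OF \<sigma>(1) has_matrix_densityD(1)[OF W2] E\<sigma>])
             (auto simp: E_def F_def Z_def U_def)
        have "dist A A' \<le> d1" "dist B B' \<le> d2"
          using n1 n2 s by (simp_all add: \<nu>E dist_norm norm_minus_commute flip: scaleR_diff_right)
        then have "c * s\<^sup>2 \<le> \<bar>v \<bullet> (B' *v (A' *v w))\<bar> * s\<^sup>2"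
          using far by (intro mult_right_mono) (simp_all add: less_imp_le)
        also have "\<dots> = \<bar>v \<bullet> (\<nu>2 E *v (\<nu>1 E *v w))\<bar>"
          using s by (simp add: \<nu>E scaleR_matrix_vector_mult matrix_vector_mult_scaleR abs_mult power2_eq_square)
        also have "\<dots> \<le> sqrt (qform (\<nu>2 E) v) * sqrt (qform (\<nu>2 E) (\<nu>1 E *v w))"
          by (rule nonneg_matrix_cauchy_schwarz[OF matrix_measure_nonneg[OF \<nu>2 E]])
        \<comment> \<open>The first factor is bounded by the trace, the second by the assumed
          coupling and then by the trace.\<close>
        also have "\<dots> \<le> sqrt (s * (norm v)\<^sup>2) * sqrt (K * (b - a)\<^sup>2 * (s * (norm w)\<^sup>2))"
        proof (intro mult_mono real_sqrt_le_mono)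
          show "qform (\<nu>2 E) v \<le> s * (norm v)\<^sup>2"
            using qform_le_trace[OF matrix_measure_nonneg[OF \<nu>2 E], of v] tr2[OF E]
            by (smt (verit) mult_right_mono s_def zero_le_power2)
          have "qform (\<nu>1 E) w \<le> s * (norm w)\<^sup>2"
            using qform_le_trace[OF matrix_measure_nonneg[OF \<nu>1 E], of w] tr1[OF E]
            by (smt (verit) mult_right_mono s_def zero_le_power2)
          then have "K * (b - a)\<^sup>2 * qform (\<nu>1 E) w \<le> K * (b - a)\<^sup>2 * (s * (norm w)\<^sup>2)"
            using K by (intro mult_left_mono) auto
          then show "qform (\<nu>2 E) (\<nu>1 E *v w) \<le> K * (b - a)\<^sup>2 * (s * (norm w)\<^sup>2)"
            using le[OF ab E, of w] by (auto simp: E_def)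
        qed (use s nonneg_matrix_qform[OF matrix_measure_nonneg[OF \<nu>2 E]] in auto)
        also have "\<dots> = sqrt K * norm v * norm w * (b - a) * s"
          using s ab by (simp add: real_sqrt_mult)
        finally have "c * s \<le> sqrt K * norm v * norm w * (b - a)"
          using s by (simp add: power2_eq_square)
        then show ?thesis using c by (simp add: C_def field_simps)
      qed
      then show "measure \<sigma> (F \<inter> cis ` {a..b}) \<le> C * (b - a)" by (simp add: s_def E_def)
    qed
    moreover have "Z U - N \<in> null_sets \<sigma>"
    proof (rule null_sets_subset[OF N(2)])
      show "Z U - N \<in> sets \<sigma>" using Zm NC by (auto simp: \<sigma>)
      show "Z U - N \<subseteq> sphere 0 1 - N" by (auto simp: Z_def sp)
    qed
    ultimately have "(Z U \<inter> N) \<union> (Z U - N) \<in> null_sets \<sigma>" unfolding F_def by (rule null_sets.Un)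
    moreover have "(Z U \<inter> N) \<union> (Z U - N) = Z U" by auto
    ultimately show ?thesis using U by auto
  qed
  \<comment> \<open>Uncountably many pairs may have a non-zero product; Lindelof's theorem reduces
    their neighbourhoods to countably many.\<close>
  define \<U> where "\<U> = {U. open U \<and> Z U \<in> null_sets \<sigma>}"
  obtain \<V> where \<V>: "\<V> \<subseteq> \<U>" "countable \<V>" "\<Union>\<V> = \<Union>\<U>"
    using Lindelof[of \<U>] by (auto simp: \<U>_def)
  have "(\<Union>U\<in>\<V>. Z U) \<in> null_sets \<sigma>"
    using \<V> by (intro null_sets_UN') (auto simp: \<U>_def)
  then show ?thesis
  proof (rule AE_I')
    show "{z \<in> space \<sigma>. W2 z ** W1 z \<noteq> 0} \<subseteq> (\<Union>U\<in>\<V>. Z U)"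
    proof clarify
      fix z assume z: "z \<in> space \<sigma>" "W2 z ** W1 z \<noteq> 0"
      then have "(W1 z, W2 z) \<in> \<Union>\<U>" using local[OF z(2)] by (auto simp: \<U>_def)
      then show "z \<in> (\<Union>U\<in>\<V>. Z U)" using z(1) \<V>(3) by (auto simp: Z_def)
    qed
  qed
qed

text \<open>With respect to the trace measure of the sum, the densities satisfy
  \<open>W2 z ** W1 z = 0\<close> almost everywhere. The projection onto the kernel of
  \<open>W1 z\<close> therefore annihilates \<open>\<nu>1\<close>, and its complement annihilates
  \<open>\<nu>2\<close>.\<close>

theorem vector_mutually_singularI:
  fixes \<nu>1 \<nu>2 :: "complex set \<Rightarrow> complex^'n^'n"
  assumes \<nu>1: "matrix_measure \<nu>1" and \<nu>2: "matrix_measure \<nu>2"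
    and N1: "N1 \<in> null_sets circle_lebesgue" "\<And>E. E \<in> sets circle_borel \<Longrightarrow> \<nu>1 (E - N1) = 0"
    and N2: "N2 \<in> null_sets circle_lebesgue" "\<And>E. E \<in> sets circle_borel \<Longrightarrow> \<nu>2 (E - N2) = 0"
    and K: "0 \<le> K"
    and le: "\<And>a b E v. 0 \<le> a \<Longrightarrow> a < b \<Longrightarrow> b \<le> 2*pi \<Longrightarrow> E \<in> sets circle_borel \<Longrightarrow>
       E \<subseteq> cis ` {a..b} \<Longrightarrow> qform (\<nu>2 E) (\<nu>1 E *v v) \<le> K * (b - a)\<^sup>2 * qform (\<nu>1 E) v"
  shows "vector_mutually_singular \<nu>1 \<nu>2"
proof -
  define \<nu> where "\<nu> = (\<lambda>E. \<nu>1 E + \<nu>2 E)"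
  define \<sigma> where "\<sigma> = trace_measure \<nu>"
  have \<nu>: "matrix_measure \<nu>" unfolding \<nu>_def by (rule matrix_measure_add[OF \<nu>1 \<nu>2])
  have \<sigma>: "finite_measure \<sigma>" "sets \<sigma> = sets circle_borel"
    by (simp_all add: \<sigma>_def finite_trace_measure[OF \<nu>])
  have m\<sigma>: "measure \<sigma> E = Re (trace (\<nu>1 E)) + Re (trace (\<nu>2 E))" if "E \<in> sets circle_borel" for E
    using measure_trace_measure[OF \<nu> that] by (simp add: \<sigma>_def \<nu>_def trace_add)
  have tr1: "Re (trace (\<nu>1 E)) \<le> measure \<sigma> E" and tr2: "Re (trace (\<nu>2 E)) \<le> measure \<sigma> E"
    if E: "E \<in> sets circle_borel" for E
    using m\<sigma>[OF E] trace_nonneg[OF matrix_measure_nonneg[OF \<nu>1 E]]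
      trace_nonneg[OF matrix_measure_nonneg[OF \<nu>2 E]] by linarith+
  interpret finite_measure \<sigma> by fact
  have ac1: "\<nu>1 E = 0" and ac2: "\<nu>2 E = 0" if E: "E \<in> null_sets \<sigma>" for E
  proof -
    have *: "E \<in> sets circle_borel" "measure \<sigma> E = 0"
      using E \<sigma>(2) by (auto simp: null_sets_def measure_def)
    show "\<nu>1 E = 0" "\<nu>2 E = 0"
      using tr1[OF *(1)] tr2[OF *(1)] *
      by (auto intro: nonneg_matrix_eq_0[OF matrix_measure_nonneg] \<nu>1 \<nu>2)
  qed
  obtain W1 where W1: "has_matrix_density \<sigma> \<nu>1 W1" using matrix_Radon_Nikodym[OF \<nu>1 \<sigma> ac1] by blast
  obtain W2 where W2: "has_matrix_density \<sigma> \<nu>2 W2" using matrix_Radon_Nikodym[OF \<nu>2 \<sigma> ac2] by blast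
  have nn1: "AE z in \<sigma>. nonneg_matrix (W1 z) \<and> Re (trace (W1 z)) \<le> 1"
    by (rule matrix_density_AE[OF \<nu>1 W1 \<sigma> tr1])
  have nn2: "AE z in \<sigma>. nonneg_matrix (W2 z) \<and> Re (trace (W2 z)) \<le> 1"
    by (rule matrix_density_AE[OF \<nu>2 W2 \<sigma> tr2])
  have NC: "N1 \<in> sets circle_borel" "N2 \<in> sets circle_borel"
    using N1(1) N2(1) by (metis null_setsD2 sets_circle_lebesgue)+
  have null: "sphere 0 1 - (N1 \<union> N2) \<in> null_sets \<sigma>"
  proof -
    let ?E = "sphere 0 1 - (N1 \<union> N2)"
    have S: "sphere 0 1 \<in> sets circle_borel" using sets.top[of circle_borel] by simp
    then have E: "?E \<in> sets circle_borel" using NC by blast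
    have "?E - N1 = ?E" "?E - N2 = ?E" by auto
    then have "\<nu>1 ?E = 0" "\<nu>2 ?E = 0" using N1(2)[OF E] N2(2)[OF E] by auto
    then show ?thesis
      using E m\<sigma>[OF E] by (simp add: null_sets_def \<sigma>(2) emeasure_eq_measure trace_def)
  qed
  have prod: "AE z in \<sigma>. W2 z ** W1 z = 0"
    by (rule density_product_eq_0[OF \<nu>1 \<nu>2 W1 W2 \<sigma> tr1 tr2 null_sets.Un[OF N1(1) N2(1)] null K le])
  define T where "T = {A :: complex^'n^'n. nonneg_matrix A} \<inter> {A. Re (trace A) \<le> 1}"
  have Tb: "T \<in> sets borel"
    unfolding T_def
    by (intro borel_closed closed_Int closed_nonneg_matrix closed_Collect_le continuous_intros
          linear_continuous_on bounded_linear_Re_trace)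
  \<comment> \<open>The projection properties are known for matrices in \<open>T\<close> and are
    required at every point of the circle, so the exceptional values of \<open>W1\<close> are
    replaced by 0, which lies in \<open>T\<close>.\<close>
  define W where "W = (\<lambda>z. if W1 z \<in> T then W1 z else 0)"
  have "0 \<in> T" by (simp add: T_def trace_def)
  then have WT: "nonneg_matrix (W z)" "Re (trace (W z)) \<le> 1" for z
    by (auto simp: W_def T_def)
  have W1m: "W1 \<in> borel_measurable circle_borel"
    using borel_measurable_integrable[OF has_matrix_densityD(1)[OF W1]]
    by (simp add: \<sigma>(2) cong: measurable_cong_sets)
  then have "W \<in> borel_measurable circle_borel"
    unfolding W_def using Tb by measurable
  then have Pm: "(\<lambda>z. kernel_projection (W z)) \<in> borel_measurable circle_borel"
    by (rule measurable_kernel_projection)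
  have WW: "AE z in \<sigma>. W z = W1 z"
    using nn1 by eventually_elim (simp add: W_def T_def)
  have c1: "AE z in \<sigma>. cadjoint (kernel_projection (W z)) ** W1 z ** kernel_projection (W z) = 0"
    using WW
  proof eventually_elim
    case (elim z)
    show ?case using kernel_projection(2)[OF WT, of z] by (simp add: elim flip: matrix_mul_assoc)
  qed
  have c2: "AE z in \<sigma>. cadjoint (mat 1 - kernel_projection (W z)) ** W2 z ** (mat 1 - kernel_projection (W z)) = 0"
    using WW prod
  proof eventually_elim
    case (elim z)
    then show ?case using kernel_projection(3)[OF WT, of "W2 z" z] by (simp flip: matrix_mul_assoc)
  qed
  show ?thesis
    unfolding vector_mutually_singular_def
  proof (intro bexI[OF _ Pm] conjI ballI)
    show "orthogonal_projection (kernel_projection (W z))" for z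
      by (rule kernel_projection(1)[OF WT])
    show "congruence_measure (\<lambda>z. kernel_projection (W z)) \<nu>1 E = 0" for E
      using nn1 by (intro congruence_measure_eq_0[OF \<nu>1 W1 \<sigma> _ c1]) (auto elim: eventually_mono)
    show "congruence_measure (\<lambda>z. mat 1 - kernel_projection (W z)) \<nu>2 E = 0" for E
      using nn2 by (intro congruence_measure_eq_0[OF \<nu>2 W2 \<sigma> _ c2]) (auto elim: eventually_mono)
  qed
qed

section \<open>The Clark measure of a small arc\<close>

text \<open>The form of a Hermitian matrix is real, so only \<open>Re c\<close> survives; this turns
  the Herglotz kernel into the Poisson kernel.\<close>

lemma qform_cscale:
  assumes "nonneg_matrix A"
  shows "qform (c *\<^sub>C A) x = Re c * qform A x"
proof -
  let ?s = "\<Sum>i\<in>UNIV. cnj (x $ i) * (A *v x) $ i"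
  have "(c *\<^sub>C A) *v x = c *s (A *v x)"
    by (simp add: vec_eq_iff cscale_def matrix_vector_mult_def sum_distrib_left mult.assoc)
  then have "qform (c *\<^sub>C A) x = Re (c * ?s)"
    by (simp add: inner_complex_vec sum_distrib_left mult_ac)
  moreover have "?s \<in> \<real>\<^sub>\<ge>\<^sub>0" using assms by (simp add: nonneg_matrix_def)
  ultimately show ?thesis
    by (simp add: inner_complex_vec complex_nonneg_Reals_iff)
qed

lemma norm_cscale: "norm (c *\<^sub>C A) = cmod c * norm (A :: complex^'n^'n)"
proof -
  have row: "norm (\<chi> j. c * r $ j) = cmod c * norm r" for r :: "complex^'n"
    by (simp add: norm_vec_def norm_mult L2_set_right_distrib)
  have "(c *\<^sub>C A) $ i = (\<chi> j. c * A $ i $ j)" for i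
    by (simp add: cscale_def)
  then have "norm (c *\<^sub>C A) = L2_set (\<lambda>i. norm (\<chi> j. c * A $ i $ j)) UNIV"
    by (simp only: norm_vec_def[of "c *\<^sub>C A"])
  also have "\<dots> = cmod c * norm A"
    by (simp add: row norm_vec_def[of A] L2_set_right_distrib)
  finally show ?thesis .
qed

text \<open>A skew-Hermitian matrix has zero real form, so the constant term of the Herglotz formula
  disappears.\<close>

lemma qform_i_Im_matrix: "qform (\<i> *\<^sub>C Im_matrix A) x = 0"
proof -
  have "\<i> *\<^sub>C Im_matrix A = (1/2) *\<^sub>R (A - cadjoint A)"
    by (simp add: vec_eq_iff cscale_def Im_matrix_def complex_eq_iff) (auto simp: field_simps)
  then show ?thesis
    by (simp add: scaleR_matrix_vector_mult matrix_vector_mult_diff_rdistrib inner_diff_right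
        inner_cadjoint inner_commute)
qed

lemma Re_Herglotz_kernel:
  assumes "norm \<zeta> = 1" "norm z < 1"
  shows "Re ((\<zeta> + z) / (\<zeta> - z)) = (1 - (cmod z)\<^sup>2) / (cmod (\<zeta> - z))\<^sup>2"
proof -
  have "(Re \<zeta>)\<^sup>2 + (Im \<zeta>)\<^sup>2 = 1"
    using assms(1) cmod_power2[of \<zeta>] by simp
  moreover have "Re (\<zeta> + z) * Re (\<zeta> - z) + Im (\<zeta> + z) * Im (\<zeta> - z)
      = ((Re \<zeta>)\<^sup>2 + (Im \<zeta>)\<^sup>2) - ((Re z)\<^sup>2 + (Im z)\<^sup>2)"
    by (simp add: power2_eq_square algebra_simps)
  ultimately have "Re (\<zeta> + z) * Re (\<zeta> - z) + Im (\<zeta> + z) * Im (\<zeta> - z) = 1 - (cmod z)\<^sup>2"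
    by (simp add: cmod_power2)
  then show ?thesis
    by (simp add: Re_divide' cmod_power2)
qed

text \<open>Over an arc of length \<open>h < 1\<close>, the point of modulus \<open>1 - h\<close>
  below an endpoint is within \<open>2 * h\<close> of the arc and satisfies
  \<open>1 - (cmod z)\<^sup>2 \<ge> h\<close>, so the Poisson kernel is at least
  \<open>h / (2 * h)\<^sup>2\<close>.\<close>

lemma Herglotz_kernel_arc:
  fixes a b :: real
  assumes "a < b"
  obtains z where "norm z < 1"
    "\<And>\<zeta>. \<zeta> \<in> cis ` {a..b} \<Longrightarrow> 1 / (4 * (b - a)) \<le> Re ((\<zeta> + z) / (\<zeta> - z))"
proof (cases "b - a < 1")
  case False
  \<comment> \<open>For long arcs the origin serves: the kernel is 1 there.\<close>
  then have "1 / (4 * (b - a)) \<le> Re ((\<zeta> + 0) / (\<zeta> - 0))" if "\<zeta> \<in> cis ` {a..b}" for \<zeta>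
    using that by (auto simp: field_simps)
  then show ?thesis using that[of 0] by simp
next
  case True
  define h where "h = b - a"
  have h: "0 < h" "h < 1" using assms True by (simp_all add: h_def)
  define z where "z = of_real (1 - h) * cis a"
  have nz: "norm z = 1 - h" using h by (simp only: z_def norm_mult norm_of_real norm_cis) simp
  show ?thesis
  proof (rule that[of z])
    show "norm z < 1" using nz h by simp
    fix \<zeta> assume "\<zeta> \<in> cis ` {a..b}"
    then obtain t where t: "a \<le> t" "t \<le> b" "\<zeta> = cis t" by auto
    have "cmod (cis t - cis a) \<le> \<bar>t - a\<bar>"
    proof -
      have "cis t - cis a = cis a * (cis (t - a) - 1)"
        by (simp add: right_diff_distrib cis_mult)
      then have "cmod (cis t - cis a) = cmod (cis (t - a) - 1)" by (simp add: norm_mult)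
      also have "\<dots> = 2 * \<bar>sin ((t - a) / 2)\<bar>"
        using dist_exp_i_1[of "t - a"] by (simp add: cis_conv_exp)
      also have "\<dots> \<le> \<bar>t - a\<bar>" using abs_sin_le_one abs_sin_x_le_abs_x[of "(t - a) / 2"] by simp
      finally show ?thesis .
    qed
    then have "cmod (cis t - cis a) \<le> h" using t by (simp add: h_def)
    moreover have "\<zeta> - z = (cis t - cis a) + of_real h * cis a"
      by (simp add: t z_def algebra_simps)
    ultimately have d: "cmod (\<zeta> - z) \<le> 2 * h"
      using norm_triangle_ineq[of "cis t - cis a" "of_real h * cis a"] h by (simp add: norm_mult)
    have "\<zeta> \<noteq> z" using nz h t(3) by (metis norm_cis diff_add_cancel less_irrefl add.right_neutral add_less_cancel_left add.commute)
    then have pos: "0 < cmod (\<zeta> - z)" by simp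
    have "1 / (4 * h) = h / (2 * h)\<^sup>2" using h by (simp add: power2_eq_square)
    also have "\<dots> \<le> h / (cmod (\<zeta> - z))\<^sup>2"
      using d pos h by (intro divide_left_mono power_mono) auto
    also have "\<dots> \<le> (1 - (cmod z)\<^sup>2) / (cmod (\<zeta> - z))\<^sup>2"
    proof (intro divide_right_mono)
      have "h * h \<le> h * 1" using h by (intro mult_left_mono) auto
      then show "h \<le> 1 - (cmod z)\<^sup>2" by (simp add: nz power2_eq_square algebra_simps)
    qed simp
    finally show "1 / (4 * (b - a)) \<le> Re ((\<zeta> + z) / (\<zeta> - z))"
      using Re_Herglotz_kernel[of \<zeta> z] nz h t by (simp add: h_def)
  qed
qed

text \<open>The Herglotz formula makes the Cayley form at \<open>x\<close> the Poisson integral of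
  the form of the density. The kernel is non-negative everywhere and at least \<open>1 / c\<close>
  on \<open>E\<close>, so dropping the complement of \<open>E\<close> leaves the bound.\<close>

lemma Clark_measure_arc_le:
  fixes b :: "complex \<Rightarrow> complex^'n^'n"
  assumes \<mu>: "is_Clark_measure b \<alpha> \<mu>" and B: "strict_contraction (b z ** cadjoint \<alpha>)"
    and z: "norm z < 1" and c: "0 < c"
    and E: "E \<in> sets circle_borel" "\<And>\<zeta>. \<zeta> \<in> E \<Longrightarrow> 1 / c \<le> Re ((\<zeta> + z) / (\<zeta> - z))"
  shows "qform (\<mu> E) x \<le> c * qform (Cayley_real (b z ** cadjoint \<alpha>)) x"
proof -
  have m\<mu>: "matrix_measure \<mu>" using \<mu> by (simp add: is_Clark_measure_def)
  let ?\<tau> = "trace_measure \<mu>" and ?V = "matrix_density \<mu>" and ?k = "\<lambda>\<zeta>. (\<zeta> + z) / (\<zeta> - z)"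
  note V = has_matrix_density_matrix_density[OF m\<mu>]
  have Vi: "integrable ?\<tau> ?V" by (rule has_matrix_densityD(1)[OF V])
  have nn: "AE \<zeta> in ?\<tau>. nonneg_matrix (?V \<zeta>)" by (rule matrix_density_nonneg_AE[OF m\<mu>])
  have far: "1 - cmod z \<le> cmod (\<zeta> - z)" if "\<zeta> \<in> sphere 0 1" for \<zeta>
    using norm_triangle_ineq2[of \<zeta> z] that by simp
  have kb: "cmod (?k \<zeta>) \<le> 2 / (1 - cmod z)" if "\<zeta> \<in> sphere 0 1" for \<zeta>
  proof -
    have "cmod (\<zeta> + z) \<le> 2" using norm_triangle_ineq[of \<zeta> z] that z by simp
    then show ?thesis
      using far[OF that] z by (simp add: norm_divide frac_le)
  qed
  have km: "?k \<in> borel_measurable ?\<tau>"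
  proof -
    have "?k \<in> borel_measurable borel" by measurable
    then show ?thesis
      by (simp add: measurable_restrict_space1 cong: measurable_cong_sets)
  qed
  \<comment> \<open>The kernel is bounded on the circle because \<open>z\<close> has positive
    distance from it.\<close>
  have kVi: "integrable ?\<tau> (\<lambda>\<zeta>. ?k \<zeta> *\<^sub>C ?V \<zeta>)"
  proof (rule Bochner_Integration.integrable_bound)
    show "integrable ?\<tau> (\<lambda>\<zeta>. (2 / (1 - cmod z)) *\<^sub>R ?V \<zeta>)" using Vi by simp
    have Vm: "?V \<in> borel_measurable ?\<tau>" using Vi by simp
    have "continuous_on UNIV (\<lambda>p :: complex \<times> (complex^'n^'n). fst p *\<^sub>C snd p)"
      unfolding cscale_def by (intro continuous_intros)
    then show "(\<lambda>\<zeta>. ?k \<zeta> *\<^sub>C ?V \<zeta>) \<in> borel_measurable ?\<tau>"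
      using borel_measurable_continuous_Pair[OF km Vm, of "(*\<^sub>C)"] by simp
    show "AE \<zeta> in ?\<tau>. norm (?k \<zeta> *\<^sub>C ?V \<zeta>) \<le> norm ((2 / (1 - cmod z)) *\<^sub>R ?V \<zeta>)"
    proof (rule AE_I2)
      fix \<zeta> assume "\<zeta> \<in> space ?\<tau>"
      then have "cmod (?k \<zeta>) * norm (?V \<zeta>) \<le> 2 / (1 - cmod z) * norm (?V \<zeta>)"
        using kb by (intro mult_right_mono) auto
      then show "norm (?k \<zeta> *\<^sub>C ?V \<zeta>) \<le> norm ((2 / (1 - cmod z)) *\<^sub>R ?V \<zeta>)"
        using z by (simp add: norm_cscale)
    qed
  qed
  note bl = bounded_linear_inner_matrix_vector[of x x]
  have "qform (Cayley_real (b z ** cadjoint \<alpha>)) x = qform (Clark_transform b \<alpha> z) x"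
    unfolding Clark_transform_def by (rule Cayley_real_qform(2)[OF B])
  also have "\<dots> = qform (\<i> *\<^sub>C Im_matrix (Clark_transform b \<alpha> 0) + matrix_integral \<mu> ?k) x"
    using \<mu> z unfolding is_Clark_measure_def by (metis dist_0_norm mem_ball)
  also have "\<dots> = qform (LINT \<zeta>|?\<tau>. ?k \<zeta> *\<^sub>C ?V \<zeta>) x"
    by (simp add: matrix_vector_mult_add_rdistrib inner_add_right qform_i_Im_matrix matrix_integral_def)
  also have "\<dots> = (LINT \<zeta>|?\<tau>. qform (?k \<zeta> *\<^sub>C ?V \<zeta>) x)"
    by (rule integral_bounded_linear[OF bl kVi, symmetric])
  finally have R: "qform (Cayley_real (b z ** cadjoint \<alpha>)) x = \<dots>" .
  have "qform (\<mu> E) x = (LINT \<zeta>:E|?\<tau>. qform (?V \<zeta>) x)"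
    by (rule bounded_linear_density[OF V bl sets_trace_measure E(1)])
  also have "\<dots> \<le> (LINT \<zeta>|?\<tau>. c * qform (?k \<zeta> *\<^sub>C ?V \<zeta>) x)"
    unfolding set_lebesgue_integral_def
  proof (rule integral_mono_AE)
    show "integrable ?\<tau> (\<lambda>\<zeta>. indicat_real E \<zeta> *\<^sub>R qform (?V \<zeta>) x)"
      using E(1) integrable_bounded_linear[OF bl Vi] by (intro integrable_mult_indicator) auto
    show "integrable ?\<tau> (\<lambda>\<zeta>. c * qform (?k \<zeta> *\<^sub>C ?V \<zeta>) x)"
      using integrable_bounded_linear[OF bl kVi] by simp
    show "AE \<zeta> in ?\<tau>. indicat_real E \<zeta> *\<^sub>R qform (?V \<zeta>) x \<le> c * qform (?k \<zeta> *\<^sub>C ?V \<zeta>) x"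
      using nn AE_space
    proof eventually_elim
      case (elim \<zeta>)
      have "norm \<zeta> = 1" using elim(2) by simp
      have q: "0 \<le> qform (?V \<zeta>) x" by (rule nonneg_matrix_qform[OF elim(1)])
      have "(cmod z)\<^sup>2 \<le> 1" using z by (simp add: power_le_one)
      then have "0 \<le> Re (?k \<zeta>)"
        by (subst Re_Herglotz_kernel[OF \<open>norm \<zeta> = 1\<close> z]) simp
      moreover have "1 \<le> c * Re (?k \<zeta>)" if "\<zeta> \<in> E"
        using E(2)[OF that] c by (simp add: field_simps)
      \<comment> \<open>One comparison combines the lower bound on \<open>E\<close> with
        non-negativity off \<open>E\<close>.\<close>
      ultimately have "indicat_real E \<zeta> \<le> c * Re (?k \<zeta>)" using c by (simp add: indicator_def)
      from mult_right_mono[OF this q] show ?case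
        by (simp only: qform_cscale[OF elim(1)] real_scaleR_def mult.assoc)
    qed
  qed
  also have "\<dots> = c * qform (Cayley_real (b z ** cadjoint \<alpha>)) x" by (simp add: R)
  finally show ?thesis .
qed

section \<open>Application to the singular parts of two Clark measures\<close>

lemma Schur_class_strict_contraction:
  fixes b :: "complex \<Rightarrow> complex^'n^'n"
  assumes "b \<in> Schur_class" "norm z < 1"
  shows "strict_contraction (b z)"
  unfolding strict_contraction_def
proof (intro allI impI)
  fix x :: "complex^'n" assume x: "x \<noteq> 0"
  have "norm (b z *v x) \<le> onorm ((*v) (b z)) * norm x"
    by (intro onorm linear_conv_bounded_linear[THEN iffD1] linear_matrix_vector_mult)
  also have "\<dots> < 1 * norm x"
    using assms x by (intro mult_strict_right_mono) (auto simp: Schur_class_def)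
  finally show "norm (b z *v x) < norm x" by simp
qed

theorem corollary4p6:
  fixes b :: "complex \<Rightarrow> complex^'n^'n" and \<alpha> :: "complex^'n^'n"
    and \<mu> \<mu>\<alpha> :: "complex set \<Rightarrow> complex^'n^'n"
  assumes "b \<in> Schur_class"
    and "unitary_matrix \<alpha>"
    and "is_Clark_measure b (mat 1) \<mu>"
    and "is_Clark_measure b \<alpha> \<mu>\<alpha>"
  shows "vector_mutually_singular (singular_part \<mu>)
           (congruence_measure (\<lambda>_. mat 1 - \<alpha>) (singular_part \<mu>\<alpha>))"
proof -
  have m: "matrix_measure \<mu>" "matrix_measure \<mu>\<alpha>"
    using assms(3,4) by (simp_all add: is_Clark_measure_def)
  note s = singular_part[OF m(1)] and s\<alpha> = singular_part[OF m(2)]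
  let ?\<nu> = "congruence_measure (\<lambda>_. mat 1 - \<alpha>) (singular_part \<mu>\<alpha>)"
  have \<nu>: "?\<nu> E = cadjoint (mat 1 - \<alpha>) ** singular_part \<mu>\<alpha> E ** (mat 1 - \<alpha>)"
    if "E \<in> sets circle_borel" for E
    by (rule congruence_measure_const[OF s\<alpha>(1) that])
  obtain N1 where N1: "N1 \<in> null_sets circle_lebesgue"
      "\<And>E. E \<in> sets circle_borel \<Longrightarrow> singular_part \<mu> (E - N1) = 0"
    using s(3) by blast
  obtain N2 where N2: "N2 \<in> null_sets circle_lebesgue"
      "\<And>E. E \<in> sets circle_borel \<Longrightarrow> singular_part \<mu>\<alpha> (E - N2) = 0"
    using s\<alpha>(3) by blast
  have N2C: "N2 \<in> sets circle_borel" using N2(1) by (metis null_setsD2 sets_circle_lebesgue)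
  show ?thesis
  proof (rule vector_mutually_singularI[OF s(1) matrix_measure_congruence[OF s\<alpha>(1)] N1 N2(1)])
    \<comment> \<open>24 is the coupling constant and 16 the square of the factor in
      \<open>4 * (c - a)\<close>.\<close>
    show "0 \<le> (24 * 16 :: real)" by simp
    show "?\<nu> (E - N2) = 0" if "E \<in> sets circle_borel" for E
      using \<nu>[of "E - N2"] that N2C N2(2)[OF that]
      by (simp add: sets.Diff bounded_bilinear.zero_left[OF bounded_bilinear_matrix_mult]
          bounded_bilinear.zero_right[OF bounded_bilinear_matrix_mult])
    fix a c :: real and E v
    assume ac: "a < c" and E: "E \<in> sets circle_borel" "E \<subseteq> cis ` {a..c}"
    \<comment> \<open>The same \<open>z\<close> must serve both measures, since the coupling
      compares Cayley forms built from a single matrix \<open>b z\<close>.\<close>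
    obtain z where z: "norm z < 1"
        "\<And>\<zeta>. \<zeta> \<in> cis ` {a..c} \<Longrightarrow> 1 / (4 * (c - a)) \<le> Re ((\<zeta> + z) / (\<zeta> - z))"
      using Herglotz_kernel_arc[OF ac] by blast
    have zE: "\<And>\<zeta>. \<zeta> \<in> E \<Longrightarrow> 1 / (4 * (c - a)) \<le> Re ((\<zeta> + z) / (\<zeta> - z))" using z(2) E(2) by blast
    have B: "strict_contraction (b z)" by (rule Schur_class_strict_contraction[OF assms(1) z(1)])
    have h: "0 < 4 * (c - a)" using ac by simp
    have "qform (\<mu> E) x \<le> 4 * (c - a) * qform (Cayley_real (b z)) x" for x
      using Clark_measure_arc_le[OF assms(3) _ z(1) h E(1) zE] B by simp
    then have M: "qform (singular_part \<mu> E) x \<le> 4 * (c - a) * qform (Cayley_real (b z)) x" for x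
      using s(2)[OF E(1), of x] order_trans by blast
    have "qform (\<mu>\<alpha> E) x \<le> 4 * (c - a) * qform (Cayley_real (b z ** cadjoint \<alpha>)) x" for x
      by (rule Clark_measure_arc_le[OF assms(4) strict_contraction_unitary[OF B assms(2)] z(1) h E(1) zE])
    then have N: "qform (singular_part \<mu>\<alpha> E) x \<le> 4 * (c - a) * qform (Cayley_real (b z ** cadjoint \<alpha>)) x" for x
      using s\<alpha>(2)[OF E(1), of x] order_trans by blast
    \<comment> \<open>The congruence moves \<open>mat 1 - \<alpha>\<close> onto the vector, where
      the coupling inequality has it.\<close>
    have "qform (?\<nu> E) (singular_part \<mu> E *v v)
        = qform (singular_part \<mu>\<alpha> E) ((mat 1 - \<alpha>) *v (singular_part \<mu> E *v v))"
      by (simp add: \<nu>[OF E(1)] inner_cadjoint flip: matrix_vector_mul_assoc)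
    also have "\<dots> \<le> 24 * (4 * (c - a))\<^sup>2 * qform (singular_part \<mu> E) v"
      using h by (intro Cayley_real_coupling_mono[OF B assms(2) _ M _ N]
          matrix_measure_nonneg[OF _ E(1)] s(1) s\<alpha>(1)) simp
    finally show "qform (?\<nu> E) (singular_part \<mu> E *v v)
        \<le> (24 * 16) * (c - a)\<^sup>2 * qform (singular_part \<mu> E) v"
      by (simp only: power_mult_distrib) simp
  qed
qed

end
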